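(* Let $Q$ be a fixed full conjunctive query with a fixed key order. On inputs $I$ that are only by a constant factor larger than the available memory $M$, the asymptotic computational (CPU) data-complexity of boxed Leapfrog Triejoin (boxed LFTJ) matches that of the in-memory version of LFTJ or is linear in $|I|$, whichever is worse. That is: for every constant $c$, if $T_{\mathrm{mem}}(N)$ denotes the worst-case CPU time of in-memory LFTJ for $Q$ on inputs of size at most $N$, then boxed LFTJ for $Q$ on inputs $I$ with $|I|\le cM$ uses CPU time $O(\max\{T_{\mathrm{mem}}(|I|),|I|\})$.
   Context: **Cost model.** Main memory holds $M$ words (one atomic value per word); secondary storage is accessed in blocks of $B$ words. Data complexity is used: the query is fixed, and constants in $O(\cdot)$ may depend on it. Standing assumptions: $|I|/B>\log|I|$, and $M/B$ is larger than, say, 10 times the number of atoms times their maximum arity. $|I|$ is the combined size of the input relations. **Queries.** A full conjunctive query $Q(x_1,\dots,x_n)\leftarrow A_1,\dots,A_m$ has body atoms $A_j$ over relation symbols and all body variables in its head. A key order (variable order) $\pi=x_1,\dots,x_n$ is fixed; no variable occurs twice in an atom, and the arguments of each atom form a subsequence of $\pi$. **In-memory LFTJ.** Backtracking search: at depth $i$, with $x_1,\dots,x_{i-1}$ bound, it enumerates in increasing order the intersection, over all atoms containing $x_i$, of the sets of values of $x_i$ occurring in tuples of that atom's relation that agree with the current binding on the earlier variables of the atom. For each value found it goes to depth $i+1$; at depth $n$ it outputs the tuple. Each intersection is computed by a leapfrog join: one iterator per sorted set, repeatedly moving (by a "seek") the iterator with the smallest value to the least element that is at least the largest current iterator value, reporting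 a value whenever all iterators agree, and stopping when an iterator passes its end. Reading the current value and testing for the end take $O(1)$ time; a seek or next takes $O(\log N)$ time, and amortized $O(1+\log(N/k))$ if $k$ keys are visited, in a set of size $N$. **TrieArrays and slices.** The trie of a $k$-ary relation $R$ stores each tuple as a root-to-leaf path, with distinct increasingly ordered children at each node. Its TrieArray consists of value arrays $\mathbf{val}_0,\dots,\mathbf{val}_{k-1}$ ($\mathbf{val}_i$ lists the trie nodes of the $i$-th column in lexicographic order) and index arrays $\mathbf{idx}_0,\dots,\mathbf{idx}_{k-2}$, where $\mathbf{idx}_i[j]$ is the position in $\mathbf{val}_{i+1}$ at which the children of node $\mathbf{val}_i[j]$ start (they end just before position $\mathbf{idx}_i[j+1]$). Input relations are given on secondary storage as TrieArrays consistent with $\pi$. For a tuple $s$ of length $p$ and values $l,h$, the slice $R^s_{l\to h}$ is $\{(t_0,\dots,t_{k-1})\in R : (t_0,\dots,t_{p-1})=s,\ l\le t_p\le h\}$. *Provisioning* a slice means copying its TrieArray (contiguous ranges of the arrays of $R$, with offset-adjusted index arrays) into memory. *Probing* $R$ with $s$, $l$ and a budget of $b$ blocks returns the maximal $h\ge l$ such that $R^s_{l\to h}$ occupies at most $b$ blocks, or SPILL if no such $h$ exists. Upper-bound values are found by binary search in the value arrays. **Boxed LFTJ.** The available memory is divided evenly among the $n$ dimensions (a constant-size output buffer is kept for writing the output append-only; memory unused at one dimension may be passed to the next). Each atom is assigned to the dimension $i$ such that $x_i$ is its first variable; let $\mathrm{atoms}[i]$ be this set. The recursive procedure BoxUp$(i)$,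 started with BoxUp$(1)$, sets $\mathrm{low}[i]=-\infty$ and repeats: (1) divide the memory of dimension $i$ evenly among all atoms to be handled at dimension $i$ (those in $\mathrm{atoms}[i]$ plus atoms spilled from earlier dimensions whose next attribute is $x_i$), and probe each from $\mathrm{low}[i]$ (with start tuple empty for atoms in $\mathrm{atoms}[i]$, and equal to the fixed prefix for spilled atoms); let $\mathrm{high}[i]$ be the minimum of the returned upper bounds; if an atom returns SPILL, set $\mathrm{high}[i]=\mathrm{low}[i]$ and mark this atom, restricted to its current attribute having the value $\mathrm{low}[i]$, as spilled, to be handled instead at the dimension of its next attribute; (2) provision the slices from $\mathrm{low}[i]$ to $\mathrm{high}[i]$ of all non-spilled atoms handled at dimension $i$; (3) if $i<n$ call BoxUp$(i+1)$, otherwise run in-memory LFTJ on all currently provisioned slices, i.e. on the box $\prod_j[\mathrm{low}[j],\mathrm{high}[j]]$; (4) set $\mathrm{low}[i]$ to the successor of $\mathrm{high}[i]$; until $\mathrm{high}[i]=\infty$. *)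

theory Defs
  imports
    Complex_Main
    "HOL-Library.List_Lexorder"
    "HOL-Library.Extended_Nat"
    "HOL-Library.Extended_Real"
    "HOL-Library.Monad_Syntax"
begin

section \<open>Queries and inputs\<close>

text \<open>
  A variable is named by its position in the key order, so the variables are
  \<open>0, \<dots>, n - 1\<close>.  Hence "the arguments of an atom form a subsequence of the key order,
  without repetition" says that the argument list is strictly increasing.  Several atoms may use
  the same relation symbol.  Atomic values are naturals, a relation is a set of value lists.
\<close>

type_synonym rel = "nat list set"

record 'r query =
  nvars :: nat
  atoms :: "('r \<times> nat list) list"

definition wf_query :: "'r query \<Rightarrow> bool" where
  "wf_query Q \<longleftrightarrow>
     0 < nvars Q \<and>
     (\<forall>(r, xs) \<in> set (atoms Q). xs \<noteq> [] \<and> sorted_wrt (<) xs \<and> set xs \<subseteq> {..<nvars Q}) \<and>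
     (\<forall>(r, xs) \<in> set (atoms Q). \<forall>(r', xs') \<in> set (atoms Q). r = r' \<longrightarrow> length xs = length xs') \<and>
     (\<forall>x<nvars Q. \<exists>(r, xs) \<in> set (atoms Q). x \<in> set xs)"

definition max_arity :: "'r query \<Rightarrow> nat" where
  "max_arity Q = Max ((\<lambda>(r, xs). length xs) ` set (atoms Q))"

definition wf_input :: "'r query \<Rightarrow> ('r \<Rightarrow> rel) \<Rightarrow> bool" where
  "wf_input Q I \<longleftrightarrow> (\<forall>(r, xs) \<in> set (atoms Q). finite (I r) \<and> (\<forall>t \<in> I r. length t = length xs))"


section \<open>TrieArrays\<close>

text \<open>
  A trie node is given by the path from the root to it; \<open>trie_level R i\<close> lists the nodes of the
  \<open>i\<close>-th column lexicographically.
\<close>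

definition trie_level :: "rel \<Rightarrow> nat \<Rightarrow> nat list list" where
  "trie_level R i = sorted_list_of_set (take (Suc i) ` R)"

definition trie_val :: "rel \<Rightarrow> nat \<Rightarrow> nat list" where
  "trie_val R i = map last (trie_level R i)"

text \<open>
  The children of node \<open>j\<close> start after those of the nodes before it.  The extra last entry marks
  the end of the children of the last node.  The empty relation has empty arrays throughout (with
  an end marker, an empty slice could exceed a tiny budget).
\<close>

definition trie_idx :: "rel \<Rightarrow> nat \<Rightarrow> nat list" where
  "trie_idx R i =
     (if R = {} then []
      else map (\<lambda>j. length (filter (\<lambda>u. butlast u \<in> set (take j (trie_level R i)))
                                   (trie_level R (Suc i))))
               [0..<Suc (length (trie_level R i))])"

record trie_array =
  vals :: "nat list list"
  idxs :: "nat list list"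

definition trie_array_of :: "nat \<Rightarrow> rel \<Rightarrow> trie_array" where
  "trie_array_of k R = \<lparr> vals = map (trie_val R) [0..<k], idxs = map (trie_idx R) [0..<k - 1] \<rparr>"

definition words :: "nat \<Rightarrow> rel \<Rightarrow> nat" where
  "words k R = sum_list (map length (vals (trie_array_of k R)))
             + sum_list (map length (idxs (trie_array_of k R)))"

definition input_size :: "'r query \<Rightarrow> ('r \<Rightarrow> rel) \<Rightarrow> nat" where
  "input_size Q I = (\<Sum>(r, k) \<in> (\<lambda>(r, xs). (r, length xs)) ` set (atoms Q). words k (I r))"

definition children :: "rel \<Rightarrow> nat list \<Rightarrow> nat set" where
  "children R s = {v. \<exists>t \<in> R. take (Suc (length s)) t = s @ [v]}"

definition slice :: "rel \<Rightarrow> nat list \<Rightarrow> nat \<Rightarrow> enat \<Rightarrow> rel" where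
  "slice R s l h =
     {t \<in> R. length s < length t \<and> take (length s) t = s \<and>
             l \<le> t ! length s \<and> enat (t ! length s) \<le> h}"


section \<open>In-memory Leapfrog Triejoin\<close>

text \<open>
  The CPU charge of all seek and next operations of an iterator that visits \<open>k\<close> keys of a set of
  size \<open>N\<close>: amortized \<open>1 + log (N/k)\<close> for each key.  As \<open>k \<le> N\<close>, this is also within the bound
  \<open>1 + log N\<close> for each operation.
\<close>

definition seek_time :: "nat \<Rightarrow> nat \<Rightarrow> real" where
  "seek_time k N = real k * (1 + ln (real N / real k))"

text \<open>
  An iterator is the list of the keys from the current one on.  Besides the intersection,
  \<open>leapfrog\<close> maintains for every iterator the number of keys it has visited.
\<close>

function leapfrog :: "nat list list \<Rightarrow> nat list \<Rightarrow> nat list \<times> nat list" where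
  "leapfrog its ks =
     (if its = [] \<or> [] \<in> set its then ([], ks)
      else
        let lo = Min (hd ` set its);
            hi = Max (hd ` set its);
            j = (LEAST j. j < length its \<and> hd (its ! j) = lo);
            it = (if lo = hi then tl (its ! j) else dropWhile (\<lambda>v. v < hi) (its ! j));
            (vs, ks') = leapfrog (its[j := it]) (ks[j := ks ! j + (if it = [] then 0 else 1)])
        in (if lo = hi then lo # vs else vs, ks'))"
  by pat_completeness auto
termination
proof (relation "measure (\<lambda>(its, ks). sum_list (map length its))", goal_cases)
  case 1
  then show ?case by simp
next
  case (2 its ks lo hi j it)
  have ne: "its \<noteq> []" "[] \<notin> set its"
    using 2(1) by auto
  have "lo \<in> hd ` set its"
    using ne(1) unfolding 2(2) by (intro Min_in) auto
  then obtain a where "a < length its" "hd (its ! a) = lo"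
    by (auto simp: in_set_conv_nth)
  then have j: "j < length its" "hd (its ! j) = lo"
    using LeastI[of "\<lambda>j. j < length its \<and> hd (its ! j) = lo" a] 2(4) by auto
  then obtain x xs where x: "its ! j = x # xs"
    using ne(2) by (metis list.exhaust nth_mem)
  have "lo \<le> hi"
    using j unfolding 2(3) by (intro Max_ge) auto
  then have less: "length it < length (its ! j)"
    using j(2) x length_dropWhile_le[of "\<lambda>v. v < hi" xs] unfolding 2(5) by auto
  have "sum_list (map length (its[j := it])) < sum_list (map length its)"
    using j(1) less member_le_sum_list[of "length (its ! j)" "map length its"]
    by (simp add: map_update sum_list_update)
  then show ?case
    by simp
qed

declare leapfrog.simps [simp del]

text \<open>
  All iterators start at their first key.  The unit for each iterator pays for opening it and for
  the test for its end.
\<close>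

definition leapfrog_join :: "nat set list \<Rightarrow> nat list \<times> real" where
  "leapfrog_join Ss =
     (let its = map sorted_list_of_set Ss;
          (vs, ks) = leapfrog its (map (\<lambda>it. if it = [] then 0 else 1) its)
      in (vs, \<Sum>(it, k) \<leftarrow> zip its ks. 1 + seek_time k (length it)))"

text \<open>
  The search takes one pair of argument list and relation per atom.  The first argument of
  \<open>lftj\<close> is the number of unbound variables; \<open>\<beta>\<close> is the binding of the earlier ones.
  It returns the output tuples and the CPU time.
\<close>

definition candidates :: "nat list \<Rightarrow> nat list \<times> rel \<Rightarrow> nat set" where
  "candidates \<beta> = (\<lambda>(xs, R). children R (map ((!) \<beta>) (takeWhile (\<lambda>x. x < length \<beta>) xs)))"

primrec lftj :: "nat \<Rightarrow> (nat list \<times> rel) list \<Rightarrow> nat list \<Rightarrow> nat list list \<times> real" where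
  "lftj 0 A \<beta> = ([\<beta>], 1)"
| "lftj (Suc d) A \<beta> =
     (let (vs, t) = leapfrog_join (map (candidates \<beta>) (filter (\<lambda>(xs, R). length \<beta> \<in> set xs) A));
          rs = map (\<lambda>v. lftj d A (\<beta> @ [v])) vs
      in (concat (map fst rs), t + sum_list (map snd rs)))"

definition mem_lftj :: "'r query \<Rightarrow> ('r \<Rightarrow> rel) \<Rightarrow> nat list list \<times> real" where
  "mem_lftj Q I = lftj (nvars Q) (map (\<lambda>(r, xs). (xs, I r)) (atoms Q)) []"

definition T_mem :: "'r query \<Rightarrow> nat \<Rightarrow> ereal" where
  "T_mem Q N = (SUP I \<in> {I. wf_input Q I \<and> input_size Q I \<le> N}. ereal (snd (mem_lftj Q I)))"


section \<open>Boxed Leapfrog Triejoin\<close>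

text \<open>
  An atom that is still to be provisioned is represented by its argument list, the prefix \<open>s\<close>
  fixed so far (empty unless it has been spilled) and its relation; it is handled at the
  dimension of its attribute \<open>length s\<close>.
\<close>

type_synonym pending = "nat list \<times> nat list \<times> rel"

text \<open>The budget \<open>b\<close> is a (not necessarily integral) number of blocks; \<open>None\<close> is SPILL.
  The greatest bound exists because the occupied space changes only at the finitely many values.\<close>

definition probe :: "nat \<Rightarrow> real \<Rightarrow> nat \<Rightarrow> pending \<Rightarrow> enat option" where
  "probe B b l = (\<lambda>(xs, s, R).
     let fits = (\<lambda>h. enat l \<le> h \<and> real (words (length xs) (slice R s l h)) / real B \<le> b)
     in if \<exists>h. fits h then Some (GREATEST h. fits h) else None)"

text \<open>
  Two binary searches among the children of the start tuple, for the lower and the upper bound;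
  each step of the latter follows the index arrays down the trie to get the size of a slice.
\<close>

definition probe_time :: "pending \<Rightarrow> real" where
  "probe_time = (\<lambda>(xs, s, R).
     real (Suc (length xs)) * (1 + log 2 (real (Suc (card (children R s))))))"

definition provision_time :: "nat list \<times> rel \<Rightarrow> real" where
  "provision_time = (\<lambda>(xs, R). 1 + real (words (length xs) R))"

definition high :: "real \<Rightarrow> nat \<Rightarrow> pending list \<Rightarrow> nat \<Rightarrow> enat" where
  "high mem B H l =
     (let ps = map (probe B (mem / real B / real (length H)) l) H
      in if None \<in> set ps then enat l else Min (insert \<infinity> (the ` set ps)))"

definition spills :: "real \<Rightarrow> nat \<Rightarrow> pending list \<Rightarrow> nat \<Rightarrow> pending \<Rightarrow> bool" where
  "spills mem B H l a \<longleftrightarrow> probe B (mem / real B / real (length H)) l a = None"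

text \<open>
  The do-until loop over the intervals of one dimension: \<open>hi l\<close> is the upper bound of the
  interval that starts at \<open>l\<close>, \<open>body l\<close> treats this interval.  \<open>None\<close> is divergence.
\<close>

partial_function (option) box_loop ::
  "(nat \<Rightarrow> enat) \<Rightarrow> (nat \<Rightarrow> (nat list list \<times> real) option) \<Rightarrow> nat \<Rightarrow> (nat list list \<times> real) option"
where
  "box_loop hi body l =
     do {
       (out, t) \<leftarrow> body l;
       (case hi l of
          \<infinity> \<Rightarrow> Some (out, t)
        | enat h \<Rightarrow> do {
            (out', t') \<leftarrow> box_loop hi body (Suc h);
            Some (out @ out', t + t')
          })
     }"

text \<open>
  \<open>box_up pass share B n d mem P A\<close> is BoxUp for the dimension \<open>n - d\<close>, with \<open>d\<close> dimensions to
  go; \<open>mem\<close> words are available for this dimension, \<open>P\<close> are the atoms not yet provisioned and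
  \<open>A\<close> the slices provisioned at earlier dimensions.  Each dimension gets \<open>share\<close> words; if
  \<open>pass\<close> is set, memory unused at one dimension is passed to the next.  The least value 0 plays
  the role of minus infinity.  A spilled atom without a next attribute is a single tuple, and is
  provisioned as such.
\<close>

primrec box_up :: "bool \<Rightarrow> real \<Rightarrow> nat \<Rightarrow> nat \<Rightarrow> nat \<Rightarrow> real \<Rightarrow> pending list \<Rightarrow> (nat list \<times> rel) list
    \<Rightarrow> (nat list list \<times> real) option" where
  "box_up pass share B n 0 mem P A = Some (lftj n A [])"
| "box_up pass share B n (Suc d) mem P A =
     (let here = (\<lambda>(xs, s, R). xs ! length s = n - Suc d);
          H = filter here P
      in box_loop (high mem B H)
           (\<lambda>l. let
               h = high mem B H l;
               S = filter (spills mem B H l) H;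
               more = (\<lambda>(xs, s, R). Suc (length s) < length xs);
               F = filter (\<lambda>a. \<not> (spills mem B H l a \<and> more a)) H;
               new = map (\<lambda>(xs, s, R). (xs, slice R s l h)) F;
               P' = map (\<lambda>(xs, s, R). (xs, s @ [l], R)) (filter more S) @ filter (Not \<circ> here) P;
               used = (\<Sum>(xs, R) \<leftarrow> new. real (words (length xs) R));
               mem' = share + (if pass then max 0 (mem - used) else 0)
             in do {
               (out, t) \<leftarrow> box_up pass share B n d mem' P' (new @ A);
               Some (out, 1 + sum_list (map probe_time H) + sum_list (map provision_time new) + t)
             })
           0)"

definition boxed_lftj ::
  "bool \<Rightarrow> nat \<Rightarrow> nat \<Rightarrow> 'r query \<Rightarrow> ('r \<Rightarrow> rel) \<Rightarrow> (nat list list \<times> real) option" where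
  "boxed_lftj pass M B Q I =
     (let share = real M / real (nvars Q)
      in box_up pass share B (nvars Q) (nvars Q) share (map (\<lambda>(r, xs). (xs, [], I r)) (atoms Q)) [])"

definition boxed_time :: "bool \<Rightarrow> nat \<Rightarrow> nat \<Rightarrow> 'r query \<Rightarrow> ('r \<Rightarrow> rel) \<Rightarrow> ereal" where
  "boxed_time pass M B Q I = (case boxed_lftj pass M B Q I of None \<Rightarrow> \<infinity> | Some (out, t) \<Rightarrow> ereal t)"

definition standing_assumptions :: "nat \<Rightarrow> nat \<Rightarrow> 'r query \<Rightarrow> ('r \<Rightarrow> rel) \<Rightarrow> bool" where
  "standing_assumptions M B Q I \<longleftrightarrow>
     log 2 (real (input_size Q I)) < real (input_size Q I) / real B \<and>
     real (10 * length (atoms Q) * max_arity Q) < real M / real B"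

end

theory Submission
  imports Defs "HOL-Library.Multiset"
begin

text \<open>
  Inside a box, LFTJ runs on subsets of the input relations.  Different atoms with the same
  relation symbol may be restricted differently, so a box need not be an input of \<open>Q\<close>; hence
  the search in a box is compared with the search on the whole input, binding by binding.  Write
  \<open>H x\<close> for the larger of \<open>x + 1\<close> and the greatest of the successors of \<open>x\<close> (least elements
  \<open>\<ge> x\<close>) in the joined sets.  In a leapfrog join each move takes an iterator from \<open>v\<close> to at least
  \<open>H v\<close>, and at most a constant number of
  iterations of \<open>H\<close> further.  So every iterator visits, up
  to a constant factor, as many keys as it takes to exhaust the sets by iterating \<open>H\<close>, and
  shrinking the sets only increases \<open>H\<close>.

  There are boundedly many boxes: whenever an interval \<open>[l, h]\<close> of a dimension ends because of an
  atom, the slice of this atom for \<open>[l, h + 1]\<close> exceeds its constant fraction of \<open>M\<close>, and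
  consecutive such slices overlap only in the value \<open>h + 1\<close>.  Each interval costs \<open>O(|I|)\<close> for probing and
  provisioning.
\<close>


section \<open>Leapfrog join and successor jumps\<close>

text \<open>With values in \<open>enat\<close>, a set without a further element has successor
  \<infinity>, the infimum of nothing, and \<infinity> is kept from then on. Exhausting a set thus
  becomes a statement about iterates.\<close>

definition nxt :: "nat set \<Rightarrow> enat \<Rightarrow> enat" where
  "nxt S x = (INF v\<in>{v \<in> S. x \<le> enat v}. enat v)"

text \<open>This is \<open>H\<close> of the overview. The term \<open>eSuc x\<close> forces progress
  when \<open>x\<close> itself lies in all sets.\<close>

definition jump :: "nat set list \<Rightarrow> enat \<Rightarrow> enat" where
  "jump Ss x = max (SUP S\<in>set Ss. nxt S x) (eSuc x)"

lemma nxt_mono: "x \<le> y \<Longrightarrow> nxt S x \<le> nxt S y"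
  unfolding nxt_def by (rule INF_superset_mono) auto

lemma nxt_antimono: "S' \<subseteq> S \<Longrightarrow> nxt S x \<le> nxt S' x"
  unfolding nxt_def by (rule INF_superset_mono) auto

lemma nxt_le: "v \<in> S \<Longrightarrow> x \<le> enat v \<Longrightarrow> nxt S x \<le> enat v"
  unfolding nxt_def by (rule INF_lower) auto

lemma nxt_le_jump: "S \<in> set Ss \<Longrightarrow> nxt S x \<le> jump Ss x"
  unfolding jump_def by (intro max.coboundedI1 SUP_upper)

lemma eSuc_le_jump: "eSuc x \<le> jump Ss x"
  by (simp add: jump_def)

lemma le_jump: "x \<le> jump Ss x"
  using eSuc_le_jump ile_eSuc order_trans by blast

lemma jump_mono: "mono (jump Ss)"
  unfolding jump_def
  by (intro monoI max.mono SUP_mono') (auto intro: nxt_mono)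

text \<open>Successors in a subset come no earlier. As \<open>jump\<close> takes a supremum, the two
  families need not correspond one to one.\<close>

lemma jump_antimono:
  assumes "\<And>S. S \<in> set Ss \<Longrightarrow> \<exists>S'\<in>set Ss'. S' \<subseteq> S"
  shows "jump Ss x \<le> jump Ss' x"
  unfolding jump_def
  by (intro max.mono SUP_mono) (use assms nxt_antimono in blast)+

lemma funpow_jump_le: "s \<le> t \<Longrightarrow> (jump Ss ^^ s) x \<le> (jump Ss ^^ t) x"
  by (rule lift_Suc_mono_le) (auto intro: le_jump)

lemma funpow_jump_mono: "x \<le> y \<Longrightarrow> (jump Ss ^^ t) x \<le> (jump Ss ^^ t) y"
  by (induction t) (auto intro: monoD[OF jump_mono])

lemma funpow_jump_antimono:
  assumes "\<And>x. jump Ss x \<le> jump Ss' x"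
  shows "(jump Ss ^^ t) x \<le> (jump Ss' ^^ t) x"
proof (induction t)
  case (Suc t)
  then show ?case
    using assms monoD[OF jump_mono, of "(jump Ss ^^ t) x" "(jump Ss' ^^ t) x" Ss]
    by (auto intro: order_trans)
qed simp

section \<open>Iterators as upper parts of the joined sets\<close>

definition tail_of :: "nat list \<Rightarrow> nat set \<Rightarrow> bool" where
  "tail_of it S \<longleftrightarrow>
     sorted_wrt (<) it \<and> set it \<subseteq> S \<and> (\<forall>x \<in> set it. \<forall>y \<in> S. x \<le> y \<longrightarrow> y \<in> set it)"

lemma tail_of_sorted_list_of_set: "finite S \<Longrightarrow> tail_of (sorted_list_of_set S) S"
  unfolding tail_of_def by auto

lemma set_dropWhile_less:
  fixes it :: "'a::linorder list"
  shows "sorted_wrt (<) it \<Longrightarrow> set (dropWhile (\<lambda>v. v < z) it) = {v \<in> set it. z \<le> v}"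
  by (induction it) auto

lemma sorted_wrt_dropWhile: "sorted_wrt P xs \<Longrightarrow> sorted_wrt P (dropWhile Q xs)"
  by (induction xs) auto

lemma tail_of_dropWhile: "tail_of it S \<Longrightarrow> tail_of (dropWhile (\<lambda>v. v < z) it) S"
  unfolding tail_of_def by (auto simp: set_dropWhile_less sorted_wrt_dropWhile)

lemma hd_le: "sorted_wrt (<) it \<Longrightarrow> x \<in> set it \<Longrightarrow> hd it \<le> (x :: nat)"
  by (cases it) auto

text \<open>Since the head of \<open>it\<close> is at most \<open>z\<close>, all elements of
  \<open>S\<close> from \<open>z\<close> on are still in \<open>it\<close>. Hence a seek in the rest
  of the iterator finds the successor in the whole of \<open>S\<close>.\<close>

lemma nxt_dropWhile:
  assumes "tail_of it S" "it \<noteq> []" "hd it \<le> z"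
  shows "dropWhile (\<lambda>v. v < z) it = [] \<Longrightarrow> nxt S z = \<infinity>"
    and "dropWhile (\<lambda>v. v < z) it \<noteq> [] \<Longrightarrow> nxt S z = hd (dropWhile (\<lambda>v. v < z) it)"
proof -
  let ?d = "dropWhile (\<lambda>v. v < z) it"
  have d: "set ?d = {v \<in> S. z \<le> v}"
  proof -
    have "v \<in> set it" if "v \<in> S" "z \<le> v" for v
      using assms(1) hd_in_set[OF assms(2)] le_trans[OF assms(3) that(2)] that(1)
      unfolding tail_of_def by blast
    moreover have "sorted_wrt (<) it" "set it \<subseteq> S"
      using assms(1) by (auto simp: tail_of_def)
    ultimately show ?thesis
      by (auto simp: set_dropWhile_less)
  qed
  have n: "nxt S z = (INF v\<in>set ?d. enat v)"
    unfolding nxt_def d by simp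
  show "?d = [] \<Longrightarrow> nxt S z = \<infinity>"
    unfolding n by (metis Inf_empty image_empty list.set(1) top_enat_def)
  assume ne: "?d \<noteq> []"
  have "sorted_wrt (<) ?d"
    using assms(1) by (auto simp: tail_of_def intro: sorted_wrt_dropWhile)
  then show "nxt S z = hd ?d"
    unfolding n using ne by (intro antisym INF_lower INF_greatest) (auto simp: hd_le)
qed

section \<open>A single move of the leapfrog join\<close>

lemma tl_eq_dropWhile:
  "sorted_wrt (<) it \<Longrightarrow> it \<noteq> [] \<Longrightarrow> tl it = dropWhile (\<lambda>v. v < Suc (hd it)) it"
  by (cases it; cases "tl it") auto

text \<open>The situation in which \<open>leapfrog\<close> recurses; the constants below name its
  local values.\<close>

locale leapfrog_step =
  fixes its :: "nat list list"
  assumes nonempty: "its \<noteq> []" "[] \<notin> set its"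
    and sorted: "\<And>it. it \<in> set its \<Longrightarrow> sorted_wrt (<) it"
begin

definition "lo = Min (hd ` set its)"
definition "hi = Max (hd ` set its)"
definition "pos = (LEAST j. j < length its \<and> hd (its ! j) = lo)"
text \<open>Makes both kinds of move one seek: the target is \<open>hi\<close> if
  \<open>lo < hi\<close>, and just past the reported key if \<open>lo = hi\<close>.\<close>

definition "goal = max hi (Suc lo)"
definition "moved = dropWhile (\<lambda>v. v < goal) (its ! pos)"

lemma pos: "pos < length its" "hd (its ! pos) = lo"
proof -
  have "lo \<in> hd ` set its"
    using nonempty unfolding lo_def by (intro Min_in) auto
  then obtain a where "a < length its" "hd (its ! a) = lo"
    by (auto simp: in_set_conv_nth)
  then show "pos < length its" "hd (its ! pos) = lo"
    using LeastI[of "\<lambda>j. j < length its \<and> hd (its ! j) = lo" a] unfolding pos_def by auto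
qed

lemma lo_le: "i < length its \<Longrightarrow> lo \<le> hd (its ! i)"
  unfolding lo_def by (intro Min_le) auto

lemma le_hi: "i < length its \<Longrightarrow> hd (its ! i) \<le> hi"
  unfolding hi_def by (intro Max_ge) auto

lemma hi_attained: "\<exists>i<length its. hd (its ! i) = hi"
proof -
  have "hi \<in> hd ` set its"
    using nonempty unfolding hi_def by (intro Max_in) auto
  then show ?thesis by (auto simp: in_set_conv_nth)
qed

lemma lo_le_hi: "lo \<le> hi"
  using pos le_hi by metis

lemma its_nth_nonempty: "i < length its \<Longrightarrow> its ! i \<noteq> []"
  using nonempty(2) by (metis nth_mem)

lemma moved_eq: "moved = (if lo = hi then tl (its ! pos) else dropWhile (\<lambda>v. v < hi) (its ! pos))"
  using tl_eq_dropWhile[OF sorted[OF nth_mem[OF pos(1)]]] its_nth_nonempty[OF pos(1)] pos lo_le_hi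
  by (cases "lo = hi") (auto simp: moved_def goal_def max_def le_Suc_eq)

lemma leapfrog_eq:
  "leapfrog its ks =
     (let (vs, ks') = leapfrog (its[pos := moved]) (ks[pos := ks ! pos + (if moved = [] then 0 else 1)])
      in (if lo = hi then lo # vs else vs, ks'))"
  unfolding moved_eq
  apply (subst leapfrog.simps)
  using nonempty by (simp add: Let_def lo_def hi_def pos_def)

lemma moved_less: "length moved < length (its ! pos)"
  using its_nth_nonempty[OF pos(1)] pos(2) length_dropWhile_le[of "\<lambda>v. v < goal" "tl (its ! pos)"]
  unfolding moved_def goal_def by (cases "its ! pos") auto

lemma set_moved: "set moved = {v \<in> set (its ! pos). goal \<le> v}"
  unfolding moved_def by (rule set_dropWhile_less) (use sorted pos in simp)

lemma sorted_moved: "sorted_wrt (<) moved"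
  unfolding moved_def by (rule sorted_wrt_dropWhile) (use sorted pos in simp)

end

section \<open>Output and visit counts of the leapfrog recursion\<close>

lemma leapfrog_trivial: "its = [] \<or> [] \<in> set its \<Longrightarrow> leapfrog its ks = ([], ks)"
  by (subst leapfrog.simps) simp

text \<open>Every move shortens one iterator, so the total length decreases. Sortedness is preserved
  and reaches the step case through the locale.\<close>

lemma leapfrog_induct [consumes 1, case_names stop step]:
  assumes sorted: "\<forall>it\<in>set its. sorted_wrt (<) it"
    and stop: "\<And>its ks. its = [] \<or> [] \<in> set its \<Longrightarrow> P its ks"
    and step: "\<And>its ks. leapfrog_step its \<Longrightarrow>
       P (its[leapfrog_step.pos its := leapfrog_step.moved its])
         (ks[leapfrog_step.pos its := ks ! leapfrog_step.pos its + (if leapfrog_step.moved its = [] then 0 else 1)])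
       \<Longrightarrow> P its ks"
  shows "P its ks"
  using sorted
proof (induction "sum_list (map length its)" arbitrary: its ks rule: less_induct)
  case less
  show ?case
  proof (cases "its = [] \<or> [] \<in> set its")
    case False
    then interpret leapfrog_step its
      by unfold_locales (use less.prems in auto)
    have "length (its ! pos) \<le> sum_list (map length its)"
      using pos(1) by (intro member_le_sum_list) auto
    then have "sum_list (map length (its[pos := moved])) < sum_list (map length its)"
      using pos(1) moved_less by (simp add: map_update sum_list_update)
    moreover have "\<forall>it\<in>set (its[pos := moved]). sorted_wrt (<) it"
      using less.prems sorted_moved set_update_subset_insert[of its pos moved] by auto
    ultimately show ?thesis
      by (intro step[OF leapfrog_step_axioms] less.hyps)
  qed (rule stop)
qed

text \<open>A move skips only keys below \<open>hi\<close> or the key just reported. The iterator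
  that stands at \<open>hi\<close> has no smaller key left, so no common key is lost.\<close>

lemma leapfrog_output:
  assumes "\<forall>it\<in>set its. sorted_wrt (<) it" "its \<noteq> []"
  shows "sorted_wrt (<) (fst (leapfrog its ks)) \<and>
         set (fst (leapfrog its ks)) = (\<Inter>it\<in>set its. set it)"
  using assms
proof (induction its ks rule: leapfrog_induct)
  case (stop its ks)
  then show ?case by (auto simp: leapfrog_trivial)
next
  case (step its ks)
  interpret leapfrog_step its by fact
  define its' where "its' = its[pos := moved]"
  obtain vs ks' where
    r: "leapfrog its' (ks[pos := ks ! pos + (if moved = [] then 0 else 1)]) = (vs, ks')"
    by fastforce
  have len: "length its' = length its" and nth:
    "\<And>i. i < length its \<Longrightarrow> its' ! i = (if i = pos then moved else its ! i)"
    by (auto simp: its'_def nth_list_update)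
  have IH: "sorted_wrt (<) vs" "set vs = (\<Inter>it\<in>set its'. set it)"
    using step.IH step.prems r unfolding its'_def by auto
  have mem': "x \<in> set vs \<longleftrightarrow> (\<forall>i<length its. x \<in> set (its' ! i))" for x
    unfolding IH(2) using len by (auto simp: in_set_conv_nth all_set_conv_all_nth)
  have mem: "x \<in> (\<Inter>it\<in>set its. set it) \<longleftrightarrow> (\<forall>i<length its. x \<in> set (its ! i))" for x
    by (auto simp: in_set_conv_nth all_set_conv_all_nth)
  have ge: "hi \<le> x" if "\<forall>i<length its. x \<in> set (its ! i)" for x
    using hi_attained that hd_le[OF sorted[OF nth_mem]] by metis
  have *: "x \<in> set vs \<longleftrightarrow> (\<forall>i<length its. x \<in> set (its ! i)) \<and> goal \<le> x" for x
  proof -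
    have "x \<in> set (its' ! i) \<longleftrightarrow> x \<in> set (its ! i) \<and> (i = pos \<longrightarrow> goal \<le> x)"
      if "i < length its" for i
      using nth[OF that] set_moved by simp
    then show ?thesis
      unfolding mem' using pos(1) by blast
  qed
  show ?case
  proof (cases "lo = hi")
    case True
    have "lo \<in> set (its ! i)" if "i < length its" for i
      using lo_le[OF that] le_hi[OF that] True hd_in_set[OF its_nth_nonempty[OF that]] by simp
    then have "set (lo # vs) = (\<Inter>it\<in>set its. set it)"
      unfolding set_eq_iff mem using ge * True
      by (auto simp: goal_def Suc_le_eq) (metis le_neq_implies_less)
    moreover have "sorted_wrt (<) (lo # vs)"
      using IH(1) * by (auto simp: goal_def)
    ultimately show ?thesis
      using True by (simp add: leapfrog_eq r[unfolded its'_def])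
  next
    case False
    then have "goal = hi"
      using lo_le_hi by (auto simp: goal_def)
    then have "set vs = (\<Inter>it\<in>set its. set it)"
      unfolding set_eq_iff mem * using ge by auto
    then show ?thesis
      using False IH by (simp add: leapfrog_eq r[unfolded its'_def])
  qed
qed

text \<open>A move that empties its iterator reaches no new key and is not counted, which makes the
  upper bound strict.\<close>

lemma leapfrog_counts:
  assumes "\<forall>it\<in>set its. sorted_wrt (<) it" "length ks = length its"
  shows "length (snd (leapfrog its ks)) = length its \<and>
    (\<forall>i<length its. its ! i \<noteq> [] \<longrightarrow>
       ks ! i \<le> snd (leapfrog its ks) ! i \<and> snd (leapfrog its ks) ! i < ks ! i + length (its ! i)) \<and>
    (\<forall>i<length its. its ! i = [] \<longrightarrow> snd (leapfrog its ks) ! i = ks ! i)"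
  using assms
proof (induction its ks rule: leapfrog_induct)
  case (stop its ks)
  then show ?case by (auto simp: leapfrog_trivial)
next
  case (step its ks)
  interpret leapfrog_step its by fact
  define ks2 where "ks2 = ks[pos := ks ! pos + (if moved = [] then 0 else 1)]"
  obtain vs ks' where r: "leapfrog (its[pos := moved]) ks2 = (vs, ks')"
    by fastforce
  have e: "snd (leapfrog its ks) = ks'"
    using r by (simp add: leapfrog_eq ks2_def)
  have IH: "length ks' = length its"
    "\<And>i. i < length its \<Longrightarrow> its[pos := moved] ! i \<noteq> [] \<Longrightarrow>
        ks2 ! i \<le> ks' ! i \<and> ks' ! i < ks2 ! i + length (its[pos := moved] ! i)"
    "\<And>i. i < length its \<Longrightarrow> its[pos := moved] ! i = [] \<Longrightarrow> ks' ! i = ks2 ! i"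
    using step.IH step.prems r unfolding ks2_def by auto
  have "ks ! i \<le> ks' ! i \<and> ks' ! i < ks ! i + length (its ! i)" if i: "i < length its" for i
    using IH(2)[OF i] IH(3)[OF i] i step.prems moved_less its_nth_nonempty[OF i]
    by (cases "i = pos"; cases "moved = []") (auto simp: ks2_def)
  then show ?case
    using IH(1) its_nth_nonempty unfolding e by auto
qed

lemma leapfrog_step_invariants:
  assumes "leapfrog_step its" "list_all2 tail_of its Ss"
  defines "its' \<equiv> its[leapfrog_step.pos its := leapfrog_step.moved its]"
  shows "list_all2 tail_of its' Ss"
    and "leapfrog_step.moved its \<noteq> [] \<Longrightarrow> [] \<notin> set its'"
    and "leapfrog_step.moved its = [] \<Longrightarrow> [] \<in> set its'"
    and "\<forall>it\<in>set its'. sorted_wrt (<) it"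
proof -
  interpret leapfrog_step its by fact
  have len: "length Ss = length its" and tails: "\<And>j. j < length its \<Longrightarrow> tail_of (its ! j) (Ss ! j)"
    using assms(2) by (auto simp: list_all2_conv_all_nth)
  show "list_all2 tail_of its' Ss"
    using tails tail_of_dropWhile[OF tails[OF pos(1)]] pos(1) len
    by (auto simp: its'_def moved_def list_all2_conv_all_nth nth_list_update)
  show "moved \<noteq> [] \<Longrightarrow> [] \<notin> set its'"
    using nonempty(2) set_update_subset_insert[of its pos moved] by (auto simp: its'_def)
  show "moved = [] \<Longrightarrow> [] \<in> set its'"
    using set_update_memI[OF pos(1), of moved] by (simp add: its'_def)
  show "\<forall>it\<in>set its'. sorted_wrt (<) it"
    using sorted sorted_moved set_update_subset_insert[of its pos moved] by (auto simp: its'_def)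
qed

text \<open>A counted move from \<open>lo\<close> ends at \<open>jump Ss lo\<close> or later. So as
  many jumps as counted moves never overtake the iterator and stay finite.\<close>

lemma leapfrog_moves_le:
  assumes "\<forall>it\<in>set its. sorted_wrt (<) it" "length ks = length its"
    "list_all2 tail_of its Ss" "[] \<notin> set its" "i < length its"
  shows "(jump Ss ^^ (snd (leapfrog its ks) ! i - ks ! i)) (enat (hd (its ! i))) < \<infinity>"
  using assms
proof (induction its ks rule: leapfrog_induct)
  case (stop its ks)
  then have "its = []" "i < length its" by simp_all
  then show ?case by simp
next
  case (step its ks)
  interpret leapfrog_step its by fact
  define its' where "its' = its[pos := moved]"
  define ks2 where "ks2 = ks[pos := ks ! pos + (if moved = [] then 0 else 1)]"
  obtain vs ks' where r: "leapfrog its' ks2 = (vs, ks')"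
    by fastforce
  have e: "snd (leapfrog its ks) = ks'"
    using r by (simp add: leapfrog_eq ks2_def its'_def)
  have i: "i < length its" by fact
  have len: "length Ss = length its" and tails: "\<And>j. j < length its \<Longrightarrow> tail_of (its ! j) (Ss ! j)"
    using step.prems(2) by (auto simp: list_all2_conv_all_nth)
  note inv = leapfrog_step_invariants[OF step.hyps step.prems(2), folded its'_def]
  have len2: "length ks2 = length its'"
    using step.prems(1) by (simp add: ks2_def its'_def)
  show ?case
  proof (cases "moved = []")
    case True
    then have "ks' = ks"
      using r inv(3) by (simp add: leapfrog_trivial ks2_def)
    then show ?thesis by (simp add: e)
  next
    case False
    have "i < length its'"
      using i by (simp add: its'_def)
    from step.IH[folded its'_def ks2_def, OF len2 inv(1) inv(2)[OF False] this]
    have IH: "(jump Ss ^^ (ks' ! i - ks2 ! i)) (enat (hd (its' ! i))) < \<infinity>"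
      by (simp add: r)
    show ?thesis
    proof (cases "i = pos")
      case False
      then show ?thesis using IH by (simp add: e its'_def ks2_def)
    next
      case True
      have k: "ks2 ! i = Suc (ks ! i)" "its' ! i = moved"
        using True \<open>moved \<noteq> []\<close> i step.prems(1) by (auto simp: ks2_def its'_def)
      have "ks2 ! i \<le> ks' ! i"
        using leapfrog_counts[OF inv(4) len2] \<open>i < length its'\<close> False unfolding k(2)[symmetric]
        by (simp add: r)
      then have s: "ks' ! i - ks ! i = Suc (ks' ! i - ks2 ! i)"
        using k by simp
      \<comment> \<open>Each set contains the head of its iterator, which lies between
        \<open>lo\<close> and \<open>hi\<close>.\<close>
      have "nxt S (enat lo) \<le> enat hi" if "S \<in> set Ss" for S
      proof -
        from that obtain j where j: "j < length its" "S = Ss ! j"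
          using len by (metis in_set_conv_nth)
        then have "hd (its ! j) \<in> S"
          using tails[OF j(1)] hd_in_set[OF its_nth_nonempty[OF j(1)]] by (auto simp: tail_of_def)
        then have "nxt S lo \<le> hd (its ! j)"
          using lo_le j by (intro nxt_le) auto
        also have "\<dots> \<le> hi" using le_hi j by simp
        finally show ?thesis .
      qed
      then have "(SUP S\<in>set Ss. nxt S lo) \<le> enat hi"
        by (rule SUP_least)
      then have "jump Ss lo \<le> enat goal"
        unfolding jump_def goal_def eSuc_enat of_nat_eq_enat[symmetric] of_nat_max
        by (intro max.mono) (auto simp: of_nat_eq_enat eSuc_enat)
      also have "goal \<le> hd moved"
        using False set_moved by (auto dest: hd_in_set)
      finally have "(jump Ss ^^ (ks' ! i - ks ! i)) lo \<le> (jump Ss ^^ (ks' ! i - ks2 ! i)) (hd moved)"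
        unfolding s funpow_Suc_right by (auto intro: funpow_jump_mono)
      then show ?thesis
        using order_le_less_trans[OF _ IH] k True pos(2) by (simp add: e)
    qed
  qed
qed


text \<open>
  The invariant: the largest current key is at most two jumps beyond the key of an iterator \<open>i\<close> for
  each iterator ahead of it.  An iterator ahead of \<open>i\<close> does not move before \<open>i\<close> does, so one move
  of another iterator adds at most two jumps and one more iterator ahead.
\<close>

lemma leapfrog_moves_ge:
  fixes Ss :: "nat set list" and higher :: "nat list list \<Rightarrow> nat \<Rightarrow> nat set"
  defines higher_def: "higher \<equiv> \<lambda>its. \<lambda>v. {l. l < length its \<and> v < hd (its ! l)}"
  assumes "\<forall>it\<in>set its. sorted_wrt (<) it" "length ks = length its"
    "list_all2 tail_of its Ss" "[] \<notin> set its"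
    "\<forall>i<length its. \<forall>j<length its.
       enat (hd (its ! j)) \<le> (jump Ss ^^ (2 * card (higher its (hd (its ! i))))) (enat (hd (its ! i)))"
    "i < length its"
  shows "(jump Ss ^^ (2 * Suc (length its) * Suc (snd (leapfrog its ks) ! i - ks ! i))) (enat (hd (its ! i))) = \<infinity>"
  using assms(2-)
proof (induction its ks rule: leapfrog_induct)
  case (stop its ks)
  then have "its = []" "i < length its" by simp_all
  then show ?case by simp
next
  case (step its ks)
  interpret leapfrog_step its by fact
  let ?g = "jump Ss"
  let ?m = "Suc (length its)"
  define its' where "its' = its[pos := moved]"
  define ks2 where "ks2 = ks[pos := ks ! pos + (if moved = [] then 0 else 1)]"
  obtain vs ks' where r: "leapfrog its' ks2 = (vs, ks')"
    by fastforce
  have e: "snd (leapfrog its ks) = ks'"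
    using r by (simp add: leapfrog_eq ks2_def its'_def)
  have i: "i < length its" by fact
  have len: "length Ss = length its" and tails: "\<And>j. j < length its \<Longrightarrow> tail_of (its ! j) (Ss ! j)"
    using step.prems(2) by (auto simp: list_all2_conv_all_nth)
  note inv = leapfrog_step_invariants[OF step.hyps step.prems(2), folded its'_def]
  have len': "length its' = length its" and len2: "length ks2 = length its'"
    using step.prems(1) by (simp_all add: ks2_def its'_def)
  let ?c = "\<lambda>i. card (higher its (hd (its ! i)))"
  have fin: "finite (higher l v)" for l v
    unfolding higher_def by (rule finite_subset[of _ "{..<length l}"]) auto
  have c_le: "?c i \<le> length its" for i
    using card_mono[of "{..<length its}" "higher its (hd (its ! i))"] by (auto simp: higher_def)
  \<comment> \<open>One jump from \<open>hi\<close> passes \<open>goal\<close>, a second one the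
    successor of \<open>goal\<close> in the moved set. By the invariant, \<open>hi\<close> is within
    \<open>2 * ?c i\<close> jumps of iterator \<open>i\<close>.\<close>
  have next_le: "nxt (Ss ! pos) goal \<le> (?g ^^ (2 * Suc (?c i))) (enat (hd (its ! i)))" if "i < length its" for i
  proof -
    have "enat goal \<le> enat (Suc hi)"
      using lo_le_hi by (simp add: goal_def)
    also have "\<dots> \<le> ?g hi"
      using eSuc_le_jump[of hi] by (simp add: eSuc_enat)
    finally have "?g goal \<le> ?g (?g hi)"
      by (rule monoD[OF jump_mono])
    moreover have "nxt (Ss ! pos) goal \<le> ?g goal"
      using len pos by (intro nxt_le_jump) auto
    ultimately have "nxt (Ss ! pos) goal \<le> (?g ^^ 2) hi"
      by (auto simp: numeral_2_eq_2)
    also have "enat hi \<le> (?g ^^ (2 * ?c i)) (enat (hd (its ! i)))"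
      using step.prems(4)[rule_format, OF that] hi_attained by metis
    then have "(?g ^^ 2) hi \<le> (?g ^^ 2) ((?g ^^ (2 * ?c i)) (enat (hd (its ! i))))"
      by (rule funpow_jump_mono)
    also have "\<dots> = (?g ^^ (2 * Suc (?c i))) (enat (hd (its ! i)))"
      unfolding comp_apply[symmetric, of "?g ^^ 2"] funpow_add[symmetric] by simp
    finally show ?thesis .
  qed
  \<comment> \<open>At most \<open>length its\<close> iterators are ahead, so this number of jumps
    pays for one move whatever the positions, including a last move that empties the
    iterator.\<close>
  have next_le': "nxt (Ss ! pos) goal \<le> (?g ^^ (2 * ?m)) (enat (hd (its ! i)))" if "i < length its" for i
    using next_le[OF that] funpow_jump_le[of "2 * Suc (?c i)" "2 * ?m" Ss "enat (hd (its ! i))"] c_le[of i]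
    by (auto intro: order_trans)
  have nxt: "moved = [] \<Longrightarrow> nxt (Ss ! pos) goal = \<infinity>" "moved \<noteq> [] \<Longrightarrow> nxt (Ss ! pos) goal = hd moved"
    using nxt_dropWhile[OF tails[OF pos(1)] its_nth_nonempty[OF pos(1)], of goal] pos(2)
    by (auto simp: moved_def goal_def)
  show ?case
  proof (cases "moved = []")
    case True
    then have "ks' = ks"
      using r inv(3) by (simp add: leapfrog_trivial ks2_def)
    then show ?thesis using next_le'[OF i] nxt(1)[OF True] by (simp add: e)
  next
    case False
    have goal_le: "goal \<le> hd moved"
      using False set_moved by (auto dest: hd_in_set)
    have nth': "its' ! j = (if j = pos then moved else its ! j)" if "j < length its" for j
      using that by (simp add: its'_def)
    have below: "enat (hd (its' ! j)) \<le> enat (hd moved)" if "j < length its" for j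
      using nth'[OF that] le_hi[OF that] goal_le by (simp add: goal_def)
    have "enat (hd moved) \<le> (?g ^^ (2 * card (higher its' (hd (its' ! i))))) (enat (hd (its' ! i)))"
      if i: "i < length its" for i
    proof (cases "hd moved \<le> hd (its' ! i)")
      case True
      then have "enat (hd moved) \<le> (?g ^^ 0) (hd (its' ! i))"
        by simp
      also have "\<dots> \<le> (?g ^^ (2 * card (higher its' (hd (its' ! i))))) (enat (hd (its' ! i)))"
        by (rule funpow_jump_le) simp
      finally show ?thesis .
    next
      case less: False
      then have i_eq: "its' ! i = its ! i"
        using nth'[OF i] by (auto split: if_splits)
      \<comment> \<open>The iterator at \<open>pos\<close> had the least key and was not ahead of
        \<open>i\<close>. After overtaking it is, and those already ahead have not moved; the new
        element of \<open>higher\<close> pays for two more jumps.\<close>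
      have "pos \<notin> higher its (hd (its ! i))"
        using lo_le[OF i] pos by (simp add: higher_def)
      moreover have "insert pos (higher its (hd (its ! i))) \<subseteq> higher its' (hd (its' ! i))"
        using less pos len' nth' lo_le[OF i] unfolding i_eq by (auto simp: higher_def)
      ultimately have "Suc (?c i) \<le> card (higher its' (hd (its' ! i)))"
        using card_mono[OF fin, of "insert pos (higher its (hd (its ! i)))"] fin by simp
      then have "(?g ^^ (2 * Suc (?c i))) (enat (hd (its ! i)))
                   \<le> (?g ^^ (2 * card (higher its' (hd (its' ! i))))) (enat (hd (its' ! i)))"
        unfolding i_eq by (intro funpow_jump_le) simp
      then show ?thesis
        using next_le[OF i] nxt(2)[OF False] by simp
    qed
    then have inv': "\<forall>i<length its'. \<forall>j<length its'.
       enat (hd (its' ! j)) \<le> (jump Ss ^^ (2 * card (higher its' (hd (its' ! i))))) (enat (hd (its' ! i)))"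
      using below unfolding len' by (blast intro: order_trans)
    from step.IH[folded its'_def ks2_def, OF len2 inv(1) inv(2)[OF False] inv', unfolded len', OF i]
    have IH: "(?g ^^ (2 * ?m * Suc (ks' ! i - ks2 ! i))) (enat (hd (its' ! i))) = \<infinity>"
      by (simp add: r)
    show ?thesis
    proof (cases "i = pos")
      case i_ne: False
      then show ?thesis using IH by (simp add: e its'_def ks2_def)
    next
      case True
      have k: "ks2 ! i = Suc (ks ! i)" "its' ! i = moved"
        using True False i step.prems(1) by (auto simp: ks2_def its'_def)
      have "ks2 ! i \<le> ks' ! i"
        using leapfrog_counts[OF inv(4) len2] i False unfolding k(2)[symmetric] len'
        by (simp add: r)
      then have "Suc (ks' ! i - ks ! i) = Suc (ks' ! i - ks2 ! i) + 1"
        using k by simp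
      then have s: "2 * ?m * Suc (ks' ! i - ks ! i) = 2 * ?m * Suc (ks' ! i - ks2 ! i) + 2 * ?m"
        by (simp only: distrib_left mult_1_right)
      have "enat (hd moved) \<le> (?g ^^ (2 * ?m)) (enat (hd (its ! i)))"
        using next_le'[OF i] nxt(2)[OF False] by simp
      then have "(?g ^^ (2 * ?m * Suc (ks' ! i - ks2 ! i))) (enat (hd moved))
          \<le> (?g ^^ (2 * ?m * Suc (ks' ! i - ks ! i))) (enat (hd (its ! i)))"
        unfolding s funpow_add comp_apply by (rule funpow_jump_mono)
      then show ?thesis
        using IH k by (simp add: e)
    qed
  qed
qed


section \<open>Leapfrog join on subsets\<close>

lemma seek_time_nonneg: "k \<le> N \<Longrightarrow> 0 \<le> seek_time k N"
proof (cases "k = 0")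
  case False
  assume "k \<le> N"
  with False have "0 \<le> ln (real N / real k)"
    by (intro ln_ge_zero) auto
  then show ?thesis by (simp add: seek_time_def)
qed (simp add: seek_time_def)

text \<open>As a function of real \<open>k\<close>, the cost has derivative
  \<open>ln (N / k)\<close>, nonnegative up to \<open>N\<close>. The proof avoids derivatives: the
  summand 1 of the cost absorbs the loss in the logarithm by
  \<open>ln y \<le> y - 1\<close>.\<close>

lemma seek_time_mono_left:
  assumes "k \<le> k'" "k' \<le> N"
  shows "seek_time k N \<le> seek_time k' N"
proof (cases "k = 0")
  case True
  then show ?thesis using seek_time_nonneg[OF assms(2)] by (simp add: seek_time_def)
next
  case False
  with assms have pos: "0 < real k" "0 < real k'" "0 < real N"
    by auto
  have "ln (real N / real k) = ln (real N / real k') + ln (real k' / real k)"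
    using pos by (simp add: ln_div)
  moreover have "ln (real k' / real k) \<le> real k' / real k - 1"
    using pos by (intro ln_le_minus_one) simp
  then have "real k * ln (real k' / real k) \<le> real k' - real k"
    using mult_left_mono[of _ _ "real k"] pos by (fastforce simp: field_simps)
  moreover have "0 \<le> (real k' - real k) * ln (real N / real k')"
    using assms pos by (intro mult_nonneg_nonneg ln_ge_zero) auto
  ultimately show ?thesis
    by (simp add: seek_time_def algebra_simps)
qed

text \<open>Up to \<kappa>, monotonicity suffices. Beyond \<kappa>, the logarithm is smaller than at
  \<kappa> and the factor \<open>K\<close> covers the number of keys.\<close>

lemma seek_time_le_mult:
  fixes K :: nat
  assumes "k \<le> K * \<kappa>" "k \<le> N'" "N' \<le> N" "\<kappa> \<le> N" "1 \<le> K"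
  shows "seek_time k N' \<le> K * seek_time \<kappa> N"
proof -
  have mono: "seek_time k N' \<le> seek_time k N"
  proof (cases "k = 0")
    case False
    then have "ln (real N' / real k) \<le> ln (real N / real k)"
      using assms by (intro ln_mono divide_right_mono) auto
    then show ?thesis by (simp add: seek_time_def mult_left_mono)
  qed (simp add: seek_time_def)
  show ?thesis
  proof (cases "k \<le> \<kappa>")
    case True
    then have "seek_time k N \<le> seek_time \<kappa> N"
      using assms by (intro seek_time_mono_left)
    also have "\<dots> \<le> K * seek_time \<kappa> N"
      using mult_right_mono[of 1 "real K"] seek_time_nonneg[OF assms(4)] assms(5) by force
    finally show ?thesis using mono by simp
  next
    case False
    then have pos: "0 < \<kappa>" "0 < k"
      using assms by (cases "\<kappa> = 0"; simp)+
    then have "ln (real N / real k) \<le> ln (real N / real \<kappa>)"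
      using assms False by (intro ln_mono divide_left_mono) auto
    moreover have "0 \<le> ln (real N / real k)"
      using assms pos by (intro ln_ge_zero) auto
    moreover have "real k \<le> real K * real \<kappa>"
      using assms(1) by (metis of_nat_le_iff of_nat_mult)
    ultimately have "real k * (1 + ln (real N / real k)) \<le> (real K * real \<kappa>) * (1 + ln (real N / real \<kappa>))"
      by (intro mult_mono) auto
    then show ?thesis using mono by (simp add: seek_time_def mult.assoc)
  qed
qed

section \<open>Visit counts bounded from both sides by jumps\<close>

definition visits :: "nat set list \<Rightarrow> nat list" where
  "visits Ss = snd (leapfrog (map sorted_list_of_set Ss)
                 (map (\<lambda>S. if sorted_list_of_set S = [] then 0 else 1) Ss))"

lemma snd_leapfrog_join:
  "snd (leapfrog_join Ss) = (\<Sum>(it, k) \<leftarrow> zip (map sorted_list_of_set Ss) (visits Ss). 1 + seek_time k (length it))"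
  unfolding leapfrog_join_def visits_def by (simp add: Let_def case_prod_beta comp_def)

lemma fst_leapfrog_join:
  assumes "\<forall>S\<in>set Ss. finite S"
  shows "distinct (fst (leapfrog_join Ss))"
    and "set (fst (leapfrog_join Ss)) = (if Ss = [] then {} else \<Inter>(set Ss))"
proof -
  let ?its = "map sorted_list_of_set Ss"
  let ?ks = "map (\<lambda>S. if sorted_list_of_set S = [] then 0 else 1) Ss"
  have e: "fst (leapfrog_join Ss) = fst (leapfrog ?its ?ks)"
    unfolding leapfrog_join_def by (simp add: Let_def case_prod_beta comp_def)
  have "distinct (fst (leapfrog_join Ss)) \<and>
        set (fst (leapfrog_join Ss)) = (if Ss = [] then {} else \<Inter>(set Ss))"
  proof (cases "Ss = []")
    case True
    then show ?thesis by (simp add: leapfrog_join_def leapfrog_trivial)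
  next
    case False
    have "set (fst (leapfrog_join Ss)) = (\<Inter>it\<in>set ?its. set it)"
      "sorted_wrt (<) (fst (leapfrog_join Ss))"
      using leapfrog_output[of ?its ?ks] False by (auto simp: e)
    moreover have "(\<Inter>it\<in>set ?its. set it) = \<Inter>(set Ss)"
      using assms by auto
    ultimately show ?thesis
      using False by (simp add: strict_sorted_iff)
  qed
  then show "distinct (fst (leapfrog_join Ss))"
    and "set (fst (leapfrog_join Ss)) = (if Ss = [] then {} else \<Inter>(set Ss))"
    by blast+
qed

lemma length_visits: "length (visits Ss) = length Ss"
  using leapfrog_counts[of "map sorted_list_of_set Ss"] by (simp add: visits_def)

lemma visits_bounds:
  assumes "finite (Ss ! i)" "i < length Ss"
  shows "visits Ss ! i \<le> card (Ss ! i)" and "Ss ! i \<noteq> {} \<Longrightarrow> 1 \<le> visits Ss ! i"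
proof -
  let ?its = "map sorted_list_of_set Ss"
  let ?ks = "map (\<lambda>S. if sorted_list_of_set S = [] then 0 else 1) Ss"
  have *: "(if Ss ! i \<noteq> {} then 1 \<le> visits Ss ! i \<and> visits Ss ! i < 1 + card (Ss ! i)
         else visits Ss ! i = 0)"
    using leapfrog_counts[of ?its ?ks] assms unfolding visits_def
    by (cases "Ss ! i = {}") (auto simp: nth_map)
  show "visits Ss ! i \<le> card (Ss ! i)" "Ss ! i \<noteq> {} \<Longrightarrow> 1 \<le> visits Ss ! i"
    using * by (auto split: if_splits)
qed

lemma visits_le_one:
  assumes "{} \<in> set Ss" "i < length Ss"
  shows "visits Ss ! i \<le> 1"
proof -
  have "[] \<in> set (map sorted_list_of_set Ss)"
    using assms(1) by force
  then show ?thesis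
    using assms(2) by (simp add: visits_def leapfrog_trivial)
qed

context
  fixes Ss :: "nat set list"
  assumes fin: "\<forall>S\<in>set Ss. finite S" and ne: "{} \<notin> set Ss"
begin

private abbreviation "its \<equiv> map sorted_list_of_set Ss"
private abbreviation "ks \<equiv> map (\<lambda>S. if sorted_list_of_set S = [] then 0 else 1 :: nat) Ss"

private lemma init:
  "\<forall>it\<in>set its. sorted_wrt (<) it" "length ks = length its" "list_all2 tail_of its Ss" "[] \<notin> set its"
proof -
  show "[] \<notin> set its"
  proof
    assume "[] \<in> set its"
    then obtain S where "S \<in> set Ss" "sorted_list_of_set S = []"
      by auto
    then show False
      using fin ne by (metis set_sorted_list_of_set list.set(1))
  qed
qed (use fin in \<open>auto simp: list_all2_conv_all_nth tail_of_sorted_list_of_set\<close>)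

private lemma init_nth: "i < length Ss \<Longrightarrow> Ss ! i \<noteq> {} \<and> finite (Ss ! i) \<and> ks ! i = 1"
  using fin ne nth_mem[of i Ss] by (cases "Ss ! i = {}") auto

private lemma first_le:
  assumes "i < length Ss" "x \<in> Ss ! i"
  shows "hd (its ! i) \<le> x"
  using assms init_nth[OF assms(1)] by (auto intro!: hd_le)

private lemma first_le_jump:
  assumes "i < length Ss"
  shows "enat (hd (its ! i)) \<le> jump Ss x"
proof -
  have "enat (hd (its ! i)) \<le> nxt (Ss ! i) x"
    unfolding nxt_def using first_le[OF assms] by (intro INF_greatest) auto
  also have "\<dots> \<le> jump Ss x"
    using assms by (intro nxt_le_jump) auto
  finally show ?thesis .
qed

text \<open>The first key is visited without a move, hence the \<open>- 1\<close>. Starting from 0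
  instead of the first key only lowers the iterates.\<close>

lemma visits_upper:
  assumes "i < length Ss"
  shows "(jump Ss ^^ (visits Ss ! i - 1)) 0 < \<infinity>"
proof -
  have "(jump Ss ^^ (visits Ss ! i - 1)) 0 \<le> (jump Ss ^^ (visits Ss ! i - 1)) (enat (hd (its ! i)))"
    by (rule funpow_jump_mono) simp
  also have "\<dots> < \<infinity>"
    using leapfrog_moves_le[OF init, of i] init_nth[OF assms] assms unfolding visits_def by simp
  finally show ?thesis .
qed

text \<open>Applies \<open>leapfrog_moves_ge\<close> to the initial iterators. One more jump takes 0
  past all first keys, which the summand 2 covers.\<close>

lemma visits_lower:
  assumes "i < length Ss"
  shows "(jump Ss ^^ (2 * Suc (length Ss) * visits Ss ! i + 2)) 0 = \<infinity>"
proof -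
  let ?higher = "\<lambda>its :: nat list list. \<lambda>v. {l. l < length its \<and> v < hd (its ! l)}"
  let ?g = "jump Ss"
  have "enat (hd (its ! j)) \<le> (?g ^^ (2 * card (?higher its (hd (its ! i))))) (enat (hd (its ! i)))"
    if i: "i < length its" and j: "j < length its" for i j
  proof (cases "hd (its ! j) \<le> hd (its ! i)")
    case True
    then have "enat (hd (its ! j)) \<le> (?g ^^ 0) (enat (hd (its ! i)))"
      by simp
    also have "\<dots> \<le> (?g ^^ (2 * card (?higher its (hd (its ! i))))) (enat (hd (its ! i)))"
      by (rule funpow_jump_le) simp
    finally show ?thesis .
  next
    case False
    then have "j \<in> ?higher its (hd (its ! i))"
      using j by simp
    \<comment> \<open>Iterator \<open>j\<close> is ahead, so the exponent is at least 2, while a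
      single jump from anywhere passes every first key.\<close>
    then have "0 < card (?higher its (hd (its ! i)))"
      unfolding card_gt_0_iff by (auto intro: finite_subset[of _ "{..<length its}"])
    have "enat (hd (its ! j)) \<le> (?g ^^ 1) (enat (hd (its ! i)))"
      using first_le_jump[of j] j by simp
    also have "\<dots> \<le> (?g ^^ (2 * card (?higher its (hd (its ! i))))) (enat (hd (its ! i)))"
      using \<open>0 < card _\<close> by (intro funpow_jump_le) simp
    finally show ?thesis .
  qed
  then have "(?g ^^ (2 * Suc (length its) * Suc (snd (leapfrog its ks) ! i - ks ! i))) (enat (hd (its ! i))) = \<infinity>"
    using assms by (intro leapfrog_moves_ge[OF init]) auto
  moreover have "Suc (snd (leapfrog its ks) ! i - ks ! i) = visits Ss ! i"
    using visits_bounds(2)[of Ss i] init_nth[OF assms] assms by (simp add: visits_def)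
  ultimately have "\<infinity> = (?g ^^ (2 * Suc (length Ss) * visits Ss ! i)) (enat (hd (its ! i)))"
    by simp
  also have "\<dots> \<le> (?g ^^ (2 * Suc (length Ss) * visits Ss ! i)) ((?g ^^ 1) 0)"
    using first_le_jump[OF assms, of 0] by (intro funpow_jump_mono) simp
  also have "\<dots> \<le> (?g ^^ (2 * Suc (length Ss) * visits Ss ! i + 2)) 0"
    unfolding comp_apply[symmetric, of "?g ^^ (2 * Suc (length Ss) * visits Ss ! i)"] funpow_add[symmetric]
    by (rule funpow_jump_le) simp
  finally show ?thesis by simp
qed

end

text \<open>The jumps that exhaust \<open>Ss\<close> also exhaust \<open>Ss'\<close>, where jumps
  are longer. More visits in \<open>Ss'\<close> would need as many jumps to stay finite.\<close>

lemma visits_antimono: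
  assumes "\<forall>S\<in>set Ss. finite S" "\<forall>S\<in>set Ss'. finite S" "{} \<notin> set Ss'"
    and sub: "\<And>S. S \<in> set Ss \<Longrightarrow> \<exists>S'\<in>set Ss'. S' \<subseteq> S"
    and "i < length Ss" "j < length Ss'"
  shows "visits Ss' ! j \<le> (2 * length Ss + 4) * visits Ss ! i"
proof (rule ccontr)
  assume less: "\<not> ?thesis"
  let ?t = "2 * Suc (length Ss) * visits Ss ! i + 2"
  have ne: "{} \<notin> set Ss"
    using sub assms(3) by (metis subset_empty)
  then have "1 \<le> visits Ss ! i"
    using visits_bounds(2)[of Ss i] assms(1,5) by (metis nth_mem)
  \<comment> \<open>As at least one key is visited, the summand 2 amounts to at most two more jumps
    per visit.\<close>
  then have "?t \<le> (2 * length Ss + 4) * visits Ss ! i"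
    by (simp add: algebra_simps)
  then have t: "?t \<le> visits Ss' ! j - 1"
    using less by linarith
  have "\<infinity> = (jump Ss ^^ ?t) 0"
    using visits_lower[OF assms(1) ne assms(5)] by simp
  also have "\<dots> \<le> (jump Ss' ^^ ?t) 0"
    by (rule funpow_jump_antimono) (rule jump_antimono[OF sub])
  also have "\<dots> \<le> (jump Ss' ^^ (visits Ss' ! j - 1)) 0"
    by (rule funpow_jump_le[OF t])
  finally show False
    using visits_upper[OF assms(2,3,6)] by simp
qed

lemma snd_leapfrog_join_eq:
  "snd (leapfrog_join Ss) = (\<Sum>i<length Ss. 1 + seek_time (visits Ss ! i) (card (Ss ! i)))"
  unfolding snd_leapfrog_join
  by (simp add: sum_list_sum_nth length_visits atLeast0LessThan length_sorted_list_of_set)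

lemma sum_nth_eq_sum_mset: "(\<Sum>i<length xs. f (xs ! i)) = (\<Sum>x\<in>#mset xs. f x)"
  using sum_list_sum_nth[of "map f xs"] sum_mset_sum_list[of "map f xs"]
  by (simp add: atLeast0LessThan)

lemma leapfrog_join_nonneg:
  assumes "\<forall>S\<in>set Ss. finite S"
  shows "0 \<le> snd (leapfrog_join Ss)"
  unfolding snd_leapfrog_join_eq
  using assms by (intro sum_nonneg add_nonneg_nonneg seek_time_nonneg visits_bounds(1)) auto

text \<open>Ties between iterators are broken by position, so the single visit counts depend on the
  order of the sets. The comparison therefore passes through one number \<kappa> and the
  cardinalities, which a permutation does not affect.\<close>

lemma snd_leapfrog_join_mono:
  assumes fin: "\<forall>S\<in>set Ss. finite S"
    and sub: "list_all2 (\<subseteq>) Ss' Ts" and perm: "mset Ts = mset Ss"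
  shows "snd (leapfrog_join Ss') \<le> real (2 * length Ss + 4) * snd (leapfrog_join Ss)"
proof -
  let ?K = "2 * length Ss + 4"
  have sets: "set Ts = set Ss" and len: "length Ss' = length Ss" "length Ts = length Ss"
    using mset_eq_setD[OF perm] mset_eq_length[OF perm] list_all2_lengthD[OF sub] by simp_all
  have sub_nth: "Ss' ! j \<subseteq> Ts ! j" if "j < length Ss" for j
    using sub len that by (simp add: list_all2_conv_all_nth)
  have fin_nth: "finite (Ss ! j)" "finite (Ts ! j)" if "j < length Ss" for j
    using fin that len sets by (metis nth_mem)+
  have fin': "\<forall>S\<in>set Ss'. finite S"
    using sub_nth fin_nth len by (metis finite_subset in_set_conv_nth)
  have sub': "\<exists>S'\<in>set Ss'. S' \<subseteq> S" if "S \<in> set Ss" for S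
    using that sub_nth len unfolding sets[symmetric] by (metis in_set_conv_nth)
  \<comment> \<open>If a set in \<open>Ss'\<close> is empty, that join stops at once and 1 works.
    Otherwise \<kappa> is the least visit count for \<open>Ss\<close>, or 0 if there are no
    sets.\<close>
  obtain \<kappa> where \<kappa>: "\<And>j. j < length Ss \<Longrightarrow> visits Ss' ! j \<le> ?K * \<kappa>"
    "\<And>i. i < length Ss \<Longrightarrow> Ss ! i \<noteq> {} \<Longrightarrow> \<kappa> \<le> visits Ss ! i"
  proof (cases "{} \<in> set Ss'")
    case True
    show ?thesis
    proof (rule that[of 1])
      show "visits Ss' ! j \<le> ?K * 1" if "j < length Ss" for j
        using visits_le_one[OF True, of j] that len by simp
    qed (use visits_bounds(2) fin_nth in simp)
  next
    case False
    show ?thesis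
    proof (cases "Ss = []")
      case True
      then show ?thesis by (intro that[of 0]) auto
    next
      case ne: False
      let ?\<kappa> = "Min ((!) (visits Ss) ` {..<length Ss})"
      have "?\<kappa> \<in> (!) (visits Ss) ` {..<length Ss}"
        using ne by (intro Min_in) auto
      then obtain i where i: "i < length Ss" "?\<kappa> = visits Ss ! i"
        by auto
      show ?thesis
      proof (rule that[of ?\<kappa>])
        show "visits Ss' ! j \<le> ?K * ?\<kappa>" if "j < length Ss" for j
          unfolding i(2) using fin fin' False sub' i(1) that len by (intro visits_antimono) auto
      qed auto
    qed
  qed
  \<comment> \<open>The minimum is for empty sets in \<open>Ss\<close>: they have no visits, while
    \<kappa> may be 1.\<close>
  let ?f = "\<lambda>S. 1 + seek_time (min \<kappa> (card S)) (card S)"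
  have "snd (leapfrog_join Ss') \<le> (\<Sum>j<length Ss. real ?K * ?f (Ts ! j))"
    unfolding snd_leapfrog_join_eq len
  proof (rule sum_mono)
    fix j assume "j \<in> {..<length Ss}"
    then have j: "j < length Ss" by simp
    have c: "visits Ss' ! j \<le> card (Ss' ! j)" "card (Ss' ! j) \<le> card (Ts ! j)"
      using visits_bounds(1)[of Ss' j] fin' sub_nth[OF j] fin_nth[OF j] j len
      by (auto intro: card_mono)
    have "visits Ss' ! j \<le> ?K * min \<kappa> (card (Ts ! j))"
    proof (cases "\<kappa> \<le> card (Ts ! j)")
      case False
      have "card (Ts ! j) \<le> ?K * card (Ts ! j)" by simp
      with c False show ?thesis by linarith
    qed (use \<kappa>(1)[OF j] in simp)
    then have "seek_time (visits Ss' ! j) (card (Ss' ! j))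
                 \<le> ?K * seek_time (min \<kappa> (card (Ts ! j))) (card (Ts ! j))"
      using c by (intro seek_time_le_mult) auto
    then show "1 + seek_time (visits Ss' ! j) (card (Ss' ! j)) \<le> ?K * ?f (Ts ! j)"
      by (simp add: algebra_simps)
  qed
  also have "\<dots> = real ?K * (\<Sum>j<length Ts. ?f (Ts ! j))"
    by (simp add: sum_distrib_left len)
  also have "\<dots> = real ?K * (\<Sum>i<length Ss. ?f (Ss ! i))"
    using sum_nth_eq_sum_mset[of ?f Ts] sum_nth_eq_sum_mset[of ?f Ss] perm by simp
  also have "\<dots> \<le> real ?K * (\<Sum>i<length Ss. 1 + seek_time (visits Ss ! i) (card (Ss ! i)))"
  proof (intro mult_left_mono sum_mono add_left_mono)
    fix i assume "i \<in> {..<length Ss}"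
    then have i: "i < length Ss" by simp
    have "min \<kappa> (card (Ss ! i)) \<le> visits Ss ! i"
      using \<kappa>(2)[OF i] by (cases "Ss ! i = {}") auto
    then show "seek_time (min \<kappa> (card (Ss ! i))) (card (Ss ! i)) \<le> seek_time (visits Ss ! i) (card (Ss ! i))"
      using visits_bounds(1)[OF fin_nth(1)[OF i] i] by (rule seek_time_mono_left)
  qed simp
  finally show ?thesis
    unfolding snd_leapfrog_join_eq .
qed


section \<open>Search on restricted relations\<close>

definition restricts :: "nat list \<times> rel \<Rightarrow> nat list \<times> rel \<Rightarrow> bool" where
  "restricts = (\<lambda>(xs, R') (ys, R). xs = ys \<and> R' \<subseteq> R)"

text \<open>The order is left open because BoxUp moves atoms between the pending and the provisioned
  ones.\<close>

definition restricted :: "(nat list \<times> rel) list \<Rightarrow> (nat list \<times> rel) list \<Rightarrow> bool" where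
  "restricted A' A \<longleftrightarrow> (\<exists>B. mset B = mset A \<and> list_all2 restricts A' B)"

lemma restricted_length: "restricted A' A \<Longrightarrow> length A' = length A"
  unfolding restricted_def by (metis list_all2_lengthD mset_eq_length)

lemma restricts_trans: "restricts a b \<Longrightarrow> restricts b c \<Longrightarrow> restricts a c"
  by (auto simp: restricts_def split: prod.splits)

lemma restricts_refl: "restricts a a"
  by (auto simp: restricts_def)

lemma restricted_refl: "restricted A A"
  unfolding restricted_def by (auto intro!: exI[of _ A] list_all2_refl restricts_refl)

text \<open>Permuting the list matched with \<open>A\<close> in the way \<open>C\<close> permutes
  \<open>A\<close> gives a list matched with \<open>A'\<close>.\<close>

lemma restricted_trans:
  assumes "restricted A' A" "restricted A B"
  shows "restricted A' B"
proof -
  obtain C where C: "mset C = mset A" "list_all2 restricts A' C"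
    using assms(1) by (auto simp: restricted_def)
  obtain D where D: "mset D = mset B" "list_all2 restricts A D"
    using assms(2) by (auto simp: restricted_def)
  obtain E where E: "list_all2 restricts C E" "mset E = mset D"
    using list_all2_reorder_left_invariance[OF D(2) C(1)] by blast
  have "list_all2 restricts A' E"
    using list_all2_trans[of restricts restricts restricts] C(2) E(1) restricts_trans by blast
  with E(2) D(1) show ?thesis
    by (auto simp: restricted_def)
qed

lemma children_subset_image: "children R s \<subseteq> (\<lambda>t. last (take (Suc (length s)) t)) ` R"
  unfolding children_def by (force intro: rev_image_eqI)

lemma finite_children: "finite R \<Longrightarrow> finite (children R s)"
  using children_subset_image by (rule finite_subset) auto

lemma card_children_le: "finite R \<Longrightarrow> card (children R s) \<le> card R"
  by (meson card_image_le card_mono children_subset_image finite_imageI order_trans)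

lemma finite_candidates: "finite (snd a) \<Longrightarrow> finite (candidates \<beta> a)"
  by (auto simp: candidates_def finite_children split: prod.splits)

lemma candidates_mono: "restricts a b \<Longrightarrow> candidates \<beta> a \<subseteq> candidates \<beta> b"
  by (auto simp: restricts_def candidates_def children_def split: prod.splits)

abbreviation active :: "(nat list \<times> rel) list \<Rightarrow> nat list \<Rightarrow> nat set list" where
  "active A \<beta> \<equiv> map (candidates \<beta>) (filter (\<lambda>(xs, R). length \<beta> \<in> set xs) A)"

lemma snd_lftj_Suc:
  "snd (lftj (Suc d) A \<beta>) = snd (leapfrog_join (active A \<beta>)) +
     (\<Sum>v\<leftarrow>fst (leapfrog_join (active A \<beta>)). snd (lftj d A (\<beta> @ [v])))"
  by (simp add: Let_def case_prod_beta comp_def)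

lemma finite_active: "\<forall>a\<in>set A. finite (snd a) \<Longrightarrow> \<forall>S\<in>set (active A \<beta>). finite S"
  by (auto intro: finite_candidates)

lemma lftj_nonneg: "\<forall>a\<in>set A. finite (snd a) \<Longrightarrow> 0 \<le> snd (lftj d A \<beta>)"
proof (induction d arbitrary: \<beta>)
  case (Suc d)
  then show ?case
    unfolding snd_lftj_Suc
    by (intro add_nonneg_nonneg leapfrog_join_nonneg finite_active sum_list_nonneg) auto
qed simp

lemma list_all2_filter:
  assumes "list_all2 P xs ys" "\<And>x y. P x y \<Longrightarrow> p x \<longleftrightarrow> q y"
  shows "list_all2 P (filter p xs) (filter q ys)"
  using assms(1) by (induction rule: list_all2_induct) (auto simp: assms(2))

text \<open>The restricted search meets only bindings of the full search and joins subsets at each.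
  The factor is lost once per binding, so it does not multiply up with the depth.\<close>

lemma lftj_restricted:
  assumes fin: "\<forall>a\<in>set A. finite (snd a)" and "restricted A' A"
  shows "snd (lftj d A' \<beta>) \<le> real (2 * length A + 4) * snd (lftj d A \<beta>)"
proof (induction d arbitrary: \<beta>)
  case (Suc d)
  let ?K = "real (2 * length A + 4)"
  obtain B where B: "mset B = mset A" "list_all2 restricts A' B"
    using assms(2) by (auto simp: restricted_def)
  have sub: "list_all2 (\<subseteq>) (active A' \<beta>) (active B \<beta>)"
    unfolding list_all2_map1 list_all2_map2
  proof (rule list_all2_mono[OF list_all2_filter[OF B(2)]])
    show "(case x of (xs, R) \<Rightarrow> length \<beta> \<in> set xs) = (case y of (xs, R) \<Rightarrow> length \<beta> \<in> set xs)"
      if "restricts x y" for x y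
      using that by (auto simp: restricts_def)
  qed (rule candidates_mono)
  have perm: "mset (active B \<beta>) = mset (active A \<beta>)"
    using B(1) by (simp add: mset_filter)
  note fin_act = finite_active[OF fin, of \<beta>]
  have "snd (leapfrog_join (active A' \<beta>))
          \<le> real (2 * length (active A \<beta>) + 4) * snd (leapfrog_join (active A \<beta>))"
    by (rule snd_leapfrog_join_mono[OF fin_act sub perm])
  also have "\<dots> \<le> ?K * snd (leapfrog_join (active A \<beta>))"
    by (intro mult_right_mono leapfrog_join_nonneg fin_act) simp
  finally have join: "snd (leapfrog_join (active A' \<beta>)) \<le> ?K * snd (leapfrog_join (active A \<beta>))" .
  let ?vs = "fst (leapfrog_join (active A \<beta>))"
  let ?vs' = "fst (leapfrog_join (active A' \<beta>))"
  have sets: "set (active B \<beta>) = set (active A \<beta>)"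
    using mset_eq_setD[OF perm] .
  have fin_act': "\<forall>S\<in>set (active A' \<beta>). finite S"
    using sub fin_act unfolding sets[symmetric]
    by (metis (no_types, lifting) finite_subset in_set_conv_nth list_all2_conv_all_nth)
  have sub': "\<exists>S'\<in>set (active A' \<beta>). S' \<subseteq> S" if "S \<in> set (active A \<beta>)" for S
    using that sub unfolding sets[symmetric]
    by (metis (no_types, lifting) in_set_conv_nth list_all2_conv_all_nth)
  have "\<Inter>(set (active A' \<beta>)) \<subseteq> \<Inter>(set (active A \<beta>))"
    by (rule Inter_greatest) (drule sub', erule bexE, rule order_trans[OF Inter_lower])
  \<comment> \<open>A join of no sets yields no value, although the intersection of no sets is
    everything; so both lists must be empty together.\<close>
  moreover have "active A' \<beta> = [] \<longleftrightarrow> active A \<beta> = []"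
    using list_all2_lengthD[OF sub] mset_eq_length[OF perm] unfolding length_0_conv[symmetric] by simp
  ultimately have "set ?vs' \<subseteq> set ?vs"
    unfolding fst_leapfrog_join(2)[OF fin_act] fst_leapfrog_join(2)[OF fin_act']
    by (simp only: split: if_splits) simp
  moreover have "(\<Sum>v\<leftarrow>?vs'. snd (lftj d A' (\<beta> @ [v]))) \<le> (\<Sum>v\<leftarrow>?vs'. ?K * snd (lftj d A (\<beta> @ [v])))"
    by (intro sum_list_mono Suc.IH)
  ultimately have "(\<Sum>v\<leftarrow>?vs'. snd (lftj d A' (\<beta> @ [v]))) \<le> (\<Sum>v\<leftarrow>?vs. ?K * snd (lftj d A (\<beta> @ [v])))"
    unfolding sum_list_distinct_conv_sum_set[OF fst_leapfrog_join(1)[OF fin_act]]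
      sum_list_distinct_conv_sum_set[OF fst_leapfrog_join(1)[OF fin_act']]
    by (elim order_trans) (intro sum_mono2 mult_nonneg_nonneg lftj_nonneg[OF fin], auto)
  with join show ?case
    unfolding snd_lftj_Suc distrib_left sum_list_const_mult by (rule add_mono)
qed simp


section \<open>Slices and probes\<close>

lemma finite_slice: "finite R \<Longrightarrow> finite (slice R s l h)"
  by (simp add: slice_def)

lemma length_trie_val: "finite R \<Longrightarrow> length (trie_val R i) = card (take (Suc i) ` R)"
  by (simp add: trie_val_def trie_level_def)

lemma length_trie_idx:
  "finite R \<Longrightarrow> length (trie_idx R i) = (if R = {} then 0 else Suc (card (take (Suc i) ` R)))"
  by (simp add: trie_idx_def trie_level_def)

text \<open>Each value array has at most one entry per tuple. An index array has at most two,
  because of its end marker.\<close>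

lemma words_le:
  assumes "finite R"
  shows "words k R \<le> 3 * k * card R"
proof -
  have "length (trie_val R i) \<le> card R" for i
    using assms by (simp add: length_trie_val card_image_le)
  then have "(\<Sum>i\<leftarrow>[0..<k]. length (trie_val R i)) \<le> (\<Sum>i\<leftarrow>[0..<k]. card R)"
    by (intro sum_list_mono)
  moreover have "length (trie_idx R i) \<le> 2 * card R" for i
    using assms card_image_le[OF assms, of "take (Suc i)"] card_gt_0_iff[of R]
    by (cases "R = {}") (simp_all add: length_trie_idx)
  then have "(\<Sum>i\<leftarrow>[0..<k - 1]. length (trie_idx R i)) \<le> (\<Sum>i\<leftarrow>[0..<k - 1]. 2 * card R)"
    by (intro sum_list_mono)
  ultimately have "words k R \<le> k * card R + (k - 1) * (2 * card R)"
    by (simp add: words_def trie_array_of_def comp_def sum_list_triv)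
  also have "\<dots> \<le> k * card R + k * (2 * card R)"
    by (intro add_left_mono mult_le_mono1) simp
  finally show ?thesis by (simp add: algebra_simps)
qed

text \<open>Prefixes of full length are the tuples themselves, so the last value array alone is long
  enough.\<close>

lemma card_le_words:
  assumes "finite R" "\<forall>t\<in>R. length t = k" "0 < k"
  shows "card R \<le> words k R"
proof -
  have "take k ` R = R"
    using assms(2) by force
  then have "card R = length (trie_val R (k - 1))"
    using assms by (simp add: length_trie_val)
  also have "\<dots> \<le> (\<Sum>i\<leftarrow>[0..<k]. length (trie_val R i))"
    using assms(3) by (intro member_le_sum_list) auto
  also have "\<dots> \<le> words k R"
    by (simp add: words_def trie_array_of_def comp_def)
  finally show ?thesis .
qed

lemma probe_None:
  assumes "probe B b l (xs, s, R) = None"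
  shows "b < real (words (length xs) (slice R s l l)) / real B"
  using assms unfolding probe_def by (auto simp: Let_def not_le split: if_splits dest: spec[of _ "enat l"])

lemma slice_bounded:
  assumes "finite R"
  shows "\<exists>b. \<forall>h\<ge>b. slice R s l (enat h) = slice R s l \<infinity>"
proof -
  have "bdd_above ((\<lambda>t. t ! length s) ` R)"
    using assms by (intro bdd_above_finite) simp
  then obtain b where b: "\<And>t. t \<in> R \<Longrightarrow> t ! length s \<le> b"
    unfolding bdd_above_def by auto
  then have "slice R s l (enat h) = slice R s l \<infinity>" if "b \<le> h" for h
    using le_trans[OF b that] by (auto simp: slice_def)
  then show ?thesis by blast
qed

text \<open>The work is to show that the greatest fitting bound is attained. \<infinity> does not
  fit, as it would be the greatest bound; since slices no longer change from \<open>b'\<close> on,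
  the fitting bounds are bounded naturals.\<close>

lemma probe_Some:
  assumes "finite R" "probe B b l (xs, s, R) = Some (enat h)"
  shows "l \<le> h" and "b < real (words (length xs) (slice R s l (Suc h))) / real B"
proof -
  let ?fits = "\<lambda>h. enat l \<le> h \<and> real (words (length xs) (slice R s l h)) / real B \<le> b"
  have ex: "\<exists>h. ?fits h" and h: "enat h = (GREATEST h. ?fits h)"
    using assms(2) unfolding probe_def by (auto simp: Let_def split: if_splits)
  have "\<not> ?fits \<infinity>"
  proof
    assume "?fits \<infinity>"
    then have "(GREATEST h. ?fits h) = \<infinity>"
      by (intro Greatest_equality) auto
    then show False using h by simp
  qed
  moreover obtain b' where b': "\<forall>h\<ge>b'. slice R s l (enat h) = slice R s l \<infinity>"
    using slice_bounded[OF assms(1)] by blast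
  ultimately have bound: "h' \<le> b'" if "?fits (enat h')" for h'
    using that by (metis enat_ord_code(3) nle_le)
  obtain h0 where "?fits (enat h0)"
    using ex \<open>\<not> ?fits \<infinity>\<close> by (metis not_infinity_eq)
  let ?g = "GREATEST h'. ?fits (enat h')"
  have g: "?fits (enat ?g)" "\<And>h'. ?fits (enat h') \<Longrightarrow> h' \<le> ?g"
    using GreatestI_nat[of "\<lambda>h'. ?fits (enat h')" h0 b'] Greatest_le_nat[of "\<lambda>h'. ?fits (enat h')" _ b']
      \<open>?fits (enat h0)\<close> bound by blast+
  have "(GREATEST h. ?fits h) = enat ?g"
  proof (rule Greatest_equality)
    show "y \<le> enat ?g" if "?fits y" for y
      using that g(2) \<open>\<not> ?fits \<infinity>\<close> by (cases y) auto
  qed (rule g(1))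
  then have hg: "h = ?g"
    using h by simp
  show "l \<le> h"
    using g(1) unfolding hg by simp
  moreover have "\<not> ?fits (enat (Suc h))"
    using g(2)[of "Suc h"] unfolding hg by auto
  ultimately show "b < real (words (length xs) (slice R s l (Suc h))) / real B"
    by auto
qed

text \<open>An atom is responsible for the bound: a spilled one, with \<open>h = l\<close>, or one
  attaining the minimum of the probes. Either way its slice up to \<open>Suc h\<close> is over
  budget; \<open>B\<close> cancels, and \<open>words_le\<close> turns words into tuples.\<close>

lemma high_finite:
  assumes "\<forall>(xs, s, R)\<in>set H. finite R" "0 < B" "high mem B H l = enat h"
  shows "l \<le> h \<and> (\<exists>(xs, s, R)\<in>set H. mem / length H < 3 * real (length xs) * card (slice R s l (Suc h)))"
proof -
  let ?b = "mem / real B / real (length H)"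
  have words: "mem / length H < 3 * real (length xs) * card (slice R s l (Suc h))"
    if "(xs, s, R) \<in> set H" "?b < real (words (length xs) (slice R s l h')) / real B" "h' \<le> Suc h"
    for xs s R h'
  proof -
    have fin: "finite R"
      using assms(1) that(1) by auto
    have "mem / length H < real (words (length xs) (slice R s l h'))"
      using that(2) assms(2) by (simp add: field_simps)
    also have "\<dots> \<le> real (3 * length xs * card (slice R s l h'))"
      using words_le[OF finite_slice[OF fin]] by (intro of_nat_mono)
    also have "card (slice R s l h') \<le> card (slice R s l (Suc h))"
    proof (intro card_mono finite_slice fin)
      have "x \<le> Suc h" if "enat x \<le> h'" for x
        using order_trans[OF that \<open>h' \<le> enat (Suc h)\<close>] by simp
      then show "slice R s l h' \<subseteq> slice R s l (Suc h)"
        by (auto simp: slice_def)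
    qed
    finally show ?thesis by (simp add: mult_left_mono)
  qed
  show ?thesis
  proof (cases "None \<in> set (map (probe B ?b l) H)")
    case True
    then have "h = l"
      using assms(3) by (simp add: high_def Let_def)
    moreover obtain xs s R where "(xs, s, R) \<in> set H" "probe B ?b l (xs, s, R) = None"
      using True by force
    ultimately show ?thesis
      using words[OF _ probe_None, of xs s R] by fastforce
  next
    case False
    then have "Min (insert \<infinity> (the ` set (map (probe B ?b l) H))) = enat h"
      using assms(3) by (auto simp: high_def Let_def)
    moreover have "Min (insert \<infinity> (the ` set (map (probe B ?b l) H)))
                     \<in> insert \<infinity> (the ` set (map (probe B ?b l) H))"
      by (intro Min_in) auto
    ultimately obtain xs s R where a: "(xs, s, R) \<in> set H" "enat h = the (probe B ?b l (xs, s, R))"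
      by force
    then have "probe B ?b l (xs, s, R) = Some (enat h)"
      using False by (metis (no_types, lifting) in_set_conv_nth length_map nth_map option.collapse)
    moreover have "finite R"
      using assms(1) a(1) by auto
    ultimately show ?thesis
      using words[OF a(1) probe_Some(2)] probe_Some(1) a(1) by fastforce
  qed
qed

text \<open>
  The second summand is shifted by one value because the slices that exceed the budget are those for
  \<open>[l, h + 1]\<close>, while the next interval starts at \<open>h + 1\<close>.
\<close>

definition ahead :: "nat \<Rightarrow> pending \<Rightarrow> nat" where
  "ahead l = (\<lambda>(xs, s, R). card (slice R s l \<infinity>) + card (slice R s (Suc l) \<infinity>))"

text \<open>As \<open>l \<le> h\<close>, the slice is covered by the ranges [l, h] and
  [l + 1, h + 1], which are what the two summands of \<open>ahead\<close> lose.\<close>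

lemma ahead_step:
  assumes "finite R" "l \<le> h"
  shows "card (slice R s l (Suc h)) + ahead (Suc h) (xs, s, R) \<le> ahead l (xs, s, R)"
proof -
  note fin = finite_slice[OF assms(1)]
  have split: "card (slice R s a \<infinity>) = card (slice R s a (enat b)) + card (slice R s (Suc b) \<infinity>)"
    if "a \<le> Suc b" for a b
  proof -
    have "slice R s a \<infinity> = slice R s a (enat b) \<union> slice R s (Suc b) \<infinity>"
      using that by (auto simp: slice_def)
    moreover have "slice R s a (enat b) \<inter> slice R s (Suc b) \<infinity> = {}"
      by (auto simp: slice_def)
    ultimately show ?thesis
      using fin by (metis card_Un_disjoint)
  qed
  have "slice R s l (Suc h) \<subseteq> slice R s l h \<union> slice R s (Suc l) (Suc h)"
    using assms(2) by (auto simp: slice_def)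
  then have "card (slice R s l (Suc h)) \<le> card (slice R s l h) + card (slice R s (Suc l) (Suc h))"
    by (meson card_Un_le card_mono fin finite_UnI order_trans)
  then show ?thesis
    using split[of l h] split[of "Suc l" "Suc h"] assms(2) by (simp add: ahead_def)
qed

lemma ahead_le: "finite R \<Longrightarrow> ahead l (xs, s, R) \<le> 2 * card R"
  using card_mono[of R "slice R s l \<infinity>"] card_mono[of R "slice R s (Suc l) \<infinity>"]
  by (fastforce simp: ahead_def slice_def)

text \<open>A potential argument: every finite interval end lowers \<phi> by \<delta>, so the body
  runs at most \<open>Suc p\<close> times. In particular the loop terminates.\<close>

lemma box_loop_bound:
  fixes \<phi> :: "nat \<Rightarrow> real"
  assumes body: "\<And>l. \<exists>out t. body l = Some (out, t) \<and> t \<le> X"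
    and dec: "\<And>l h. hi l = enat h \<Longrightarrow> \<phi> (Suc h) + \<delta> \<le> \<phi> l"
    and nonneg: "\<And>l. 0 \<le> \<phi> l" and "0 < \<delta>" and "0 \<le> X" and "\<phi> l \<le> real p * \<delta>"
  shows "\<exists>out t. box_loop hi body l = Some (out, t) \<and> t \<le> real (Suc p) * X"
  using assms(6)
proof (induction p arbitrary: l)
  case 0
  obtain out t where b: "body l = Some (out, t)" "t \<le> X"
    using body by blast
  \<comment> \<open>No potential is left, and another finite interval end would make it
    negative.\<close>
  have "hi l = \<infinity>"
  proof (rule ccontr)
    assume "hi l \<noteq> \<infinity>"
    then obtain h where "hi l = enat h"
      by auto
    from dec[OF this] nonneg[of "Suc h"] 0 \<open>0 < \<delta>\<close> show False
      by simp
  qed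
  then show ?case
    using b by (subst box_loop.simps) simp
next
  case (Suc p)
  obtain out t where b: "body l = Some (out, t)" "t \<le> X"
    using body by blast
  show ?case
  proof (cases "hi l")
    case (enat h)
    have "\<phi> (Suc h) \<le> real p * \<delta>"
      using dec[OF enat] Suc.prems by (simp add: algebra_simps)
    then obtain out' t' where "box_loop hi body (Suc h) = Some (out', t')" "t' \<le> real (Suc p) * X"
      using Suc.IH by blast
    then show ?thesis
      using b enat by (subst box_loop.simps) (simp add: algebra_simps)
  next
    case infinity
    have "t \<le> real (Suc (Suc p)) * X"
      using b(2) \<open>0 \<le> X\<close> mult_right_mono[of 1 "real (Suc (Suc p))" X] by simp
    then show ?thesis
      using b infinity by (subst box_loop.simps) simp
  qed
qed


section \<open>The number of boxes\<close>

text \<open>The cost recurrence over the dimensions to go: \<open>Suc p\<close> intervals, each with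
  cost factor \<open>E\<close> for probing and provisioning plus the inner dimensions;
  \<open>K\<close> stands for LFTJ in one box.\<close>

primrec box_factor :: "nat \<Rightarrow> real \<Rightarrow> real \<Rightarrow> nat \<Rightarrow> real" where
  "box_factor p E K 0 = K"
| "box_factor p E K (Suc d) = real (Suc p) * (E + box_factor p E K d)"

lemma box_factor_nonneg: "0 \<le> E \<Longrightarrow> 0 \<le> K \<Longrightarrow> 0 \<le> box_factor p E K d"
  by (induction d) auto

lemma sum_list_le_length_mult:
  assumes "\<And>x. x \<in> set xs \<Longrightarrow> f x \<le> (c :: real)" "0 \<le> c" "length xs \<le> m"
  shows "sum_list (map f xs) \<le> real m * c"
proof -
  have "sum_list (map f xs) \<le> (\<Sum>x\<leftarrow>xs. c)"
    using assms(1) by (intro sum_list_mono)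
  also have "\<dots> = real (length xs) * c"
    by (simp add: sum_list_triv)
  also have "\<dots> \<le> real m * c"
    using assms by (intro mult_right_mono) auto
  finally show ?thesis .
qed

lemma real_sum_list: "real (\<Sum>x\<leftarrow>xs. f x) = (\<Sum>x\<leftarrow>xs. real (f x))"
  by (induction xs) auto

abbreviation pending_atom :: "pending \<Rightarrow> nat list \<times> rel" where
  "pending_atom \<equiv> \<lambda>(xs, s, R). (xs, R)"

text \<open>The lower bound \<open>i\<close> on the next attribute ensures that nothing is pending
  once all dimensions are done, since attributes lie below \<open>n\<close>.\<close>

definition pending_ok :: "nat \<Rightarrow> nat \<Rightarrow> nat \<Rightarrow> pending \<Rightarrow> bool" where
  "pending_ok n N i = (\<lambda>(xs, s, R). sorted_wrt (<) xs \<and> length s < length xs \<and> set xs \<subseteq> {..<n} \<and>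
     i \<le> xs ! length s \<and> finite R \<and> card R \<le> N)"

lemma pending_ok_length:
  assumes "pending_ok n N i (xs, s, R)"
  shows "length xs \<le> n"
proof -
  have "distinct xs" "set xs \<subseteq> {..<n}"
    using assms by (auto simp: pending_ok_def strict_sorted_iff)
  then show ?thesis
    using card_mono[of "{..<n}" "set xs"] by (simp add: distinct_card)
qed

text \<open>Bounding the logarithm linearly is affordable, because each interval may cost
  O(N).\<close>

lemma probe_time_le:
  assumes "pending_ok n N i a"
  shows "probe_time a \<le> real (Suc n) * (1 + real N)"
proof -
  obtain xs s R where a: "a = (xs, s, R)"
    by (cases a)
  let ?k = "card (children R s)"
  have "?k \<le> N"
    using assms card_children_le[of R s] by (auto simp: pending_ok_def a)
  have "Suc ?k \<le> 2 ^ ?k"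
    by (simp add: Suc_leI less_exp)
  then have "real (Suc ?k) \<le> 2 ^ ?k"
    by (metis of_nat_le_iff of_nat_numeral of_nat_power)
  then have "log 2 (real (Suc ?k)) \<le> real ?k"
    by (simp add: log_le_iff powr_realpow)
  then have "1 + log 2 (real (Suc ?k)) \<le> 1 + real N"
    using \<open>?k \<le> N\<close> by simp
  moreover have "0 \<le> log 2 (real (Suc ?k))"
    by simp
  ultimately show ?thesis
    using pending_ok_length[of n N i xs s R] assms
    unfolding a probe_time_def by (auto intro!: mult_mono)
qed

lemma provision_time_le:
  assumes "pending_ok n N i (xs, s, R)" "R' \<subseteq> R"
  shows "provision_time (xs, R') \<le> 1 + 3 * real n * real N"
proof -
  have "finite R" "card R \<le> N"
    using assms(1) by (auto simp: pending_ok_def)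
  then have "finite R'" "card R' \<le> N"
    using assms(2) card_mono[of R R'] finite_subset by auto
  have "words (length xs) R' \<le> 3 * length xs * card R'"
    by (rule words_le) fact
  also have "\<dots> \<le> 3 * n * N"
    using pending_ok_length[OF assms(1)] \<open>card R' \<le> N\<close> by (intro mult_mono) auto
  finally have "real (words (length xs) R') \<le> real (3 * n * N)"
    by (rule of_nat_mono)
  then show ?thesis
    by (simp add: provision_time_def)
qed

text \<open>The atom that ends the interval has a slice of at least this size: its budget is at
  least \<open>share / m\<close>, and a tuple accounts for at most \<open>3 * n\<close> words. No
  other atom gains potential.\<close>

lemma ahead_sum_step:
  assumes H: "\<forall>a\<in>set H. pending_ok n N i a" and "length H \<le> m" "0 < B" "0 < share" "share \<le> mem" "0 < n"
    and high: "high mem B H l = enat h"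
  shows "real (\<Sum>a\<leftarrow>H. ahead (Suc h) a) + share / (3 * real n * real m) \<le> real (\<Sum>a\<leftarrow>H. ahead l a)"
proof -
  let ?w = "\<lambda>(xs, s, R). card (slice R s l (Suc h))"
  have "\<forall>(xs, s, R)\<in>set H. finite R"
    using H by (auto simp: pending_ok_def)
  from high_finite[OF this \<open>0 < B\<close> high] obtain xs s R where
    le: "l \<le> h" and a: "(xs, s, R) \<in> set H"
    and big: "mem / length H < 3 * real (length xs) * card (slice R s l (Suc h))"
    by auto
  have m: "0 < length H" "0 < m"
    using a assms(2) by (auto simp: length_pos_if_in_set intro: length_pos_if_in_set[THEN less_le_trans])
  have "share / real m \<le> mem / real (length H)"
    using assms m by (intro frac_le) auto
  also note big
  also have "3 * real (length xs) * card (slice R s l (Suc h)) \<le> 3 * real n * card (slice R s l (Suc h))"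
    using pending_ok_length H a by (intro mult_right_mono mult_left_mono) auto
  finally have "share / (3 * real n * real m) \<le> real (card (slice R s l (Suc h)))"
    using m \<open>0 < n\<close> by (simp add: field_simps)
  also have "card (slice R s l (Suc h)) \<le> (\<Sum>a\<leftarrow>H. ?w a)"
    using a by (intro member_le_sum_list) (force, simp)
  finally have "share / (3 * real n * real m) \<le> real (\<Sum>a\<leftarrow>H. ?w a)"
    by simp
  moreover have "(\<Sum>a\<leftarrow>H. ?w a + ahead (Suc h) a) \<le> (\<Sum>a\<leftarrow>H. ahead l a)"
  proof (rule sum_list_mono)
    fix a assume "a \<in> set H"
    moreover obtain xs s R where a: "a = (xs, s, R)"
      by (cases a)
    ultimately have "finite R"
      using H by (auto simp: pending_ok_def)
    from ahead_step[OF this le] show "?w a + ahead (Suc h) a \<le> ahead l a"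
      by (simp add: a)
  qed
  then have "real (\<Sum>a\<leftarrow>H. ?w a) + real (\<Sum>a\<leftarrow>H. ahead (Suc h) a) \<le> real (\<Sum>a\<leftarrow>H. ahead l a)"
    unfolding sum_list_addf of_nat_add[symmetric] by (rule of_nat_mono)
  ultimately show ?thesis
    by linarith
qed

text \<open>The induction maintains that pending and provisioned atoms together restrict the input
  atoms \<open>At\<close>. Hence \<open>lftj_restricted\<close> applies in every box, and
  \<open>p\<close> bounds the number of finite intervals in each loop.\<close>

lemma box_up_bound:
  fixes At :: "(nat list \<times> rel) list" and X share :: real and n N p B :: nat
  defines "m \<equiv> length At"
  defines "E \<equiv> 1 + real m * (2 * real (Suc n)) + real m * (1 + 3 * real n)"
  assumes At: "\<forall>a\<in>set At. finite (snd a)"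
    and B: "0 < B" and share: "0 < share" "6 * real n * real m * real m * real N \<le> real p * share"
    and X: "1 \<le> X" "real N \<le> X" "snd (lftj n At []) \<le> X"
    and "0 < m" "d \<le> n" "share \<le> mem"
    and "\<forall>a\<in>set P. pending_ok n N (n - d) a" "restricted (map pending_atom P @ A) At"
  shows "\<exists>out t. box_up pass share B n d mem P A = Some (out, t) \<and>
           t \<le> box_factor p E (real (2 * m + 4)) d * X"
  using assms(11-)
proof (induction d arbitrary: mem P A)
  case 0
  have "P = []"
  proof (rule ccontr)
    assume "P \<noteq> []"
    then obtain xs s R where "(xs, s, R) \<in> set P"
      by (metis prod_cases3 hd_in_set)
    then have "xs ! length s \<in> {..<n}" "n \<le> xs ! length s"
      using 0 nth_mem by (fastforce simp: pending_ok_def)+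
    then show False by simp
  qed
  then have "restricted A At"
    using 0 by simp
  then have "snd (lftj n A []) \<le> real (2 * m + 4) * snd (lftj n At [])"
    unfolding m_def by (rule lftj_restricted[OF At])
  also have "\<dots> \<le> real (2 * m + 4) * X"
    using X(3) by (rule mult_left_mono) simp
  finally show ?case
    by (simp add: prod_eq_iff)
next
  case (Suc d)
  let ?Y = "box_factor p E (real (2 * m + 4))"
  define here where "here = (\<lambda>(xs :: nat list, s :: nat list, R :: rel). xs ! length s = n - Suc d)"
  define H where "H = filter here P"
  define more where "more = (\<lambda>(xs :: nat list, s :: nat list, R :: rel). Suc (length s) < length xs)"
  define F where "F l = filter (\<lambda>a. \<not> (spills mem B H l a \<and> more a)) H" for l
  define new where "new l = map (\<lambda>(xs, s, R). (xs, slice R s l (high mem B H l))) (F l)" for l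
  define P' where "P' l = map (\<lambda>(xs, s, R). (xs, s @ [l], R)) (filter more (filter (spills mem B H l) H))
                            @ filter (Not \<circ> here) P" for l
  define mem' where "mem' l = share + (if pass then max 0 (mem - (\<Sum>(xs, R) \<leftarrow> new l. real (words (length xs) R))) else 0)" for l
  define body where "body l = do {
               (out, t) \<leftarrow> box_up pass share B n d (mem' l) (P' l) (new l @ A);
               Some (out, 1 + sum_list (map probe_time H) + sum_list (map provision_time (new l)) + t)
             }" for l
  have eq: "box_up pass share B n (Suc d) mem P A = box_loop (high mem B H) body 0"
    unfolding box_up.simps Let_def body_def mem'_def P'_def new_def F_def more_def H_def here_def ..
  have H: "\<forall>a\<in>set H. pending_ok n N (n - Suc d) a"
    using Suc.prems by (auto simp: H_def)
  have len: "length P \<le> m"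
    using restricted_length[OF Suc.prems(4)] by (simp add: m_def)
  have lenH: "length H \<le> m"
    unfolding H_def using length_filter_le[of here P] len by linarith
  have n: "0 < n"
    using Suc.prems by simp
  have E: "0 \<le> E"
    by (simp add: E_def)
  have body: "\<exists>out t. body l = Some (out, t) \<and> t \<le> (E + ?Y d) * X" for l
  proof -
    have "\<forall>a\<in>set (P' l). pending_ok n N (n - d) a"
    proof
      fix a assume "a \<in> set (P' l)"
      then consider (spilled) xs s R where "(xs, s, R) \<in> set H" "Suc (length s) < length xs" "a = (xs, s @ [l], R)"
        | (later) "a \<in> set P" "\<not> here a"
        unfolding P'_def more_def by auto
      then show "pending_ok n N (n - d) a"
      proof cases
        case spilled
        then have "xs ! length s = n - Suc d" "sorted_wrt (<) xs"
          using H by (auto simp: H_def here_def pending_ok_def)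
        \<comment> \<open>The next attribute of a spilled atom comes later in the key order, so its
          dimension is still to come.\<close>
        moreover have "xs ! length s < xs ! Suc (length s)"
          using \<open>sorted_wrt (<) xs\<close> spilled(2) by (simp add: sorted_wrt_iff_nth_less)
        ultimately show ?thesis
          using H spilled Suc.prems(1) by (auto simp: pending_ok_def)
      next
        case later
        then show ?thesis
          using Suc.prems(1,3) by (auto simp: here_def pending_ok_def)
      qed
    qed
    moreover have "restricted (map pending_atom (P' l) @ new l @ A) At"
    proof (rule restricted_trans[OF _ Suc.prems(4)])
      \<comment> \<open>\<open>?D\<close> is the old list in the new order, before slicing. Only the
        part \<open>F l\<close> shrinks: a spilled atom keeps its relation and merely extends its
        prefix.\<close>
      let ?sp = "\<lambda>a. spills mem B H l a \<and> more a"
      let ?D = "map pending_atom (filter ?sp H) @ map pending_atom (filter (Not \<circ> here) P) @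
                map pending_atom (F l) @ A"
      have H_split: "mset H = mset (filter ?sp H) + mset (F l)"
        unfolding F_def mset_filter by (rule multiset_partition)
      have "mset P = mset H + mset (filter (Not \<circ> here) P)"
        unfolding H_def mset_filter comp_def by (rule multiset_partition)
      then have "image_mset pending_atom (mset P) =
          image_mset pending_atom (mset (filter ?sp H) + mset (F l) + mset (filter (Not \<circ> here) P))"
        unfolding H_split by (rule arg_cong)
      then have "mset ?D = mset (map pending_atom P @ A)"
        by (simp del: mset_filter add: ac_simps)
      moreover have "map pending_atom (P' l) = map pending_atom (filter ?sp H) @ map pending_atom (filter (Not \<circ> here) P)"
        unfolding P'_def filter_filter by (auto simp: conj_commute)
      then have "list_all2 restricts (map pending_atom (P' l) @ new l @ A) ?D"
        unfolding new_def
        by (auto intro!: list_all2_appendI list_all2_refl restricts_refl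
            simp: list_all2_map1 list_all2_map2 restricts_def slice_def list.rel_refl_strong list_all2_same)
      ultimately show "restricted (map pending_atom (P' l) @ new l @ A) (map pending_atom P @ A)"
        unfolding restricted_def by blast
    qed
    moreover have "share \<le> mem' l"
      by (simp add: mem'_def)
    ultimately obtain out t where t: "box_up pass share B n d (mem' l) (P' l) (new l @ A) = Some (out, t)"
      "t \<le> ?Y d * X"
      using Suc.IH[of "mem' l" "P' l" "new l @ A"] Suc.prems(1) by auto
    have "sum_list (map probe_time H) \<le> real m * (real (Suc n) * (1 + real N))"
      using H lenH by (intro sum_list_le_length_mult probe_time_le) auto
    also have "\<dots> \<le> real m * (real (Suc n) * (2 * X))"
      using X by (intro mult_left_mono) auto
    finally have probes: "sum_list (map probe_time H) \<le> real m * (2 * real (Suc n)) * X"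
      by (simp add: mult_ac)
    have "sum_list (map provision_time (new l)) \<le> real m * (1 + 3 * real n * real N)"
    proof (rule sum_list_le_length_mult)
      fix a assume "a \<in> set (new l)"
      then obtain xs s R where "(xs, s, R) \<in> set H" "a = (xs, slice R s l (high mem B H l))"
        unfolding new_def F_def by auto
      then show "provision_time a \<le> 1 + 3 * real n * real N"
        using H provision_time_le[of n N "n - Suc d" xs s R "slice R s l (high mem B H l)"]
        by (auto simp: slice_def)
    next
      show "length (new l) \<le> m"
        unfolding new_def F_def length_map by (rule order_trans[OF length_filter_le lenH])
    qed simp
    also have "\<dots> \<le> real m * (X + 3 * real n * X)"
      using X by (intro mult_left_mono add_mono) auto
    finally have provs: "sum_list (map provision_time (new l)) \<le> real m * (1 + 3 * real n) * X"
      by (simp add: algebra_simps)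
    have "1 + sum_list (map probe_time H) + sum_list (map provision_time (new l)) + t \<le> (E + ?Y d) * X"
      using X(1) probes provs t(2) by (simp only: E_def distrib_right mult_1_left)
    then show ?thesis
      using t(1) by (simp add: body_def)
  qed
  let ?\<phi> = "\<lambda>l. real (\<Sum>a\<leftarrow>H. ahead l a)"
  let ?\<delta> = "share / (3 * real n * real m)"
  \<comment> \<open>At most \<open>m\<close> atoms start with potential at most \<open>2 * N\<close>
    each; dividing by \<delta> leads to the factor 6 in the assumption on \<open>p\<close>.\<close>
  have "?\<phi> 0 \<le> real p * ?\<delta>"
  proof -
    have "?\<phi> 0 = (\<Sum>a\<leftarrow>H. real (ahead 0 a))"
      by (rule real_sum_list)
    also have "\<dots> \<le> real m * (2 * real N)"
    proof (rule sum_list_le_length_mult[OF _ _ lenH])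
      fix a assume "a \<in> set H"
      then show "real (ahead 0 a) \<le> 2 * real N"
        using H ahead_le[of "snd (snd a)" 0 "fst a" "fst (snd a)"] by (auto simp: pending_ok_def)
    qed simp
    also have "\<dots> \<le> real p * ?\<delta>"
      using share(2) n \<open>0 < m\<close> by (simp add: field_simps)
    finally show ?thesis .
  qed
  moreover have "0 < ?\<delta>"
    using share n \<open>0 < m\<close> by simp
  moreover have "0 \<le> (E + ?Y d) * X"
    using E X(1) box_factor_nonneg[of E "real (2 * m + 4)" p d] by simp
  ultimately have "\<exists>out t. box_loop (high mem B H) body 0 = Some (out, t) \<and> t \<le> real (Suc p) * ((E + ?Y d) * X)"
    using body ahead_sum_step[OF H lenH B share(1) Suc.prems(2) n]
    by (intro box_loop_bound[where \<phi> = ?\<phi> and \<delta> = ?\<delta>]) auto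
  then show ?case
    unfolding eq by (simp add: mult.assoc)
qed


section \<open>The constants for a given query\<close>

lemma words_le_input_size:
  assumes "(r, xs) \<in> set (atoms Q)"
  shows "words (length xs) (I r) \<le> input_size Q I"
proof -
  have "(r, length xs) \<in> (\<lambda>(r, xs). (r, length xs)) ` set (atoms Q)"
    using assms by force
  then have "(\<lambda>(r, k). words k (I r)) (r, length xs) \<le> input_size Q I"
    unfolding input_size_def by (intro member_le_sum) auto
  then show ?thesis by simp
qed

theorem theorem14:
  fixes Q :: "'r query" and c :: real
  assumes "wf_query Q"
  shows "\<exists>C::real. \<forall>(I :: 'r \<Rightarrow> rel) (M :: nat) (B :: nat) (pass :: bool).
           wf_input Q I \<longrightarrow> standing_assumptions M B Q I \<longrightarrow>
           real (input_size Q I) \<le> c * real M \<longrightarrow>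
           boxed_time pass M B Q I
             \<le> ereal C * max (T_mem Q (input_size Q I)) (ereal (real (input_size Q I)))"
proof -
  let ?n = "nvars Q"
  let ?m = "length (atoms Q)"
  \<comment> \<open>Solves 6 n m^2 N \<le> p * share for share = M / n and N \<le> c M.\<close>
  let ?p = "nat \<lceil>6 * real ?n * real ?n * real ?m * real ?m * c\<rceil>"
  let ?E = "1 + real ?m * (2 * real (Suc ?n)) + real ?m * (1 + 3 * real ?n)"
  let ?C = "box_factor ?p ?E (real (2 * ?m + 4)) ?n"
  show ?thesis
  proof (intro exI[of _ ?C] allI impI)
    fix I :: "'r \<Rightarrow> rel" and M B :: nat and pass :: bool
    assume I: "wf_input Q I" and st: "standing_assumptions M B Q I" and size: "real (input_size Q I) \<le> c * real M"
    let ?N = "input_size Q I"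
    let ?At = "map (\<lambda>(r, xs). (xs, I r)) (atoms Q)"
    let ?P = "map (\<lambda>(r, xs). (xs, [], I r)) (atoms Q) :: pending list"
    let ?share = "real M / real ?n"
    \<comment> \<open>The cost on this very input; the worst case \<open>T_mem\<close> enters only
      at the end.\<close>
    define X where "X = max (snd (mem_lftj Q I)) (real ?N)"
    have n: "0 < ?n"
      using assms by (simp add: wf_query_def)
    have "atoms Q \<noteq> []"
      using assms n by (force simp: wf_query_def)
    then have m: "0 < ?m"
      by simp
    \<comment> \<open>Both \<open>log 2 0\<close> and \<open>0 / B\<close> are 0, so size 0 violates
      the strict inequality.\<close>
    have "?N \<noteq> 0"
    proof
      assume "?N = 0"
      then show False using st by (simp add: standing_assumptions_def log_def)
    qed
    then have N: "1 \<le> ?N"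
      by simp
    then have "0 \<le> log 2 (real ?N)"
      by simp
    \<comment> \<open>Division by 0 gives 0, which cannot exceed the logarithm.\<close>
    then have B: "0 < B"
      using st by (cases "B = 0") (auto simp: standing_assumptions_def)
    have "0 < M"
      using size N by (cases "M = 0") auto
    have "6 * real ?n * real ?n * real ?m * real ?m * c \<le> real ?p"
      by linarith
    then have "6 * real ?n * real ?n * real ?m * real ?m * c * ?share \<le> real ?p * ?share"
      by (rule mult_right_mono) simp
    moreover have "6 * real ?n * real ?m * real ?m * real ?N \<le> 6 * real ?n * real ?m * real ?m * (c * real M)"
      using size by (rule mult_left_mono) simp
    moreover have "6 * real ?n * real ?m * real ?m * (c * real M) = 6 * real ?n * real ?n * real ?m * real ?m * c * ?share"
      using n by simp
    ultimately have share: "6 * real ?n * real ?m * real ?m * real ?N \<le> real ?p * ?share"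
      by linarith
    have ok: "\<forall>a\<in>set ?P. pending_ok ?n ?N (?n - ?n) a"
    proof
      fix a assume "a \<in> set ?P"
      then obtain r xs where a: "(r, xs) \<in> set (atoms Q)" "a = (xs, [], I r)"
        by auto
      then have xs: "xs \<noteq> []" "sorted_wrt (<) xs" "set xs \<subseteq> {..<?n}"
        and R: "finite (I r)" "\<forall>t\<in>I r. length t = length xs"
        using assms I by (auto simp: wf_query_def wf_input_def)
      have "card (I r) \<le> ?N"
        using card_le_words[OF R] words_le_input_size[OF a(1), of I] xs(1) by simp
      then show "pending_ok ?n ?N (?n - ?n) a"
        using xs R by (simp add: pending_ok_def a)
    qed
    have "map pending_atom ?P @ [] = ?At"
      by (auto simp: comp_def)
    then have "restricted (map pending_atom ?P @ []) ?At"
      using restricted_refl by metis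
    moreover have "\<forall>a\<in>set ?At. finite (snd a)"
      using I by (auto simp: wf_input_def)
    moreover have "snd (lftj ?n ?At []) \<le> X" "real ?N \<le> X" "1 \<le> X"
      using N by (auto simp: X_def mem_lftj_def)
    ultimately have "\<exists>out t. box_up pass ?share B ?n ?n ?share ?P [] = Some (out, t) \<and> t \<le> ?C * X"
      using box_up_bound[of ?At B ?share ?n ?N ?p X ?n ?share ?P "[]" pass] B share ok n m \<open>0 < M\<close>
      by simp
    then obtain out t where "boxed_lftj pass M B Q I = Some (out, t)" "t \<le> ?C * X"
      unfolding boxed_lftj_def Let_def by blast
    then have "boxed_time pass M B Q I \<le> ereal ?C * ereal X"
      by (simp add: boxed_time_def)
    also have "ereal X \<le> max (T_mem Q ?N) (ereal (real ?N))"
    proof -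
      have "ereal (snd (mem_lftj Q I)) \<le> T_mem Q ?N"
        unfolding T_mem_def using I by (intro SUP_upper) simp
      moreover have "ereal X = max (ereal (snd (mem_lftj Q I))) (ereal (real ?N))"
        by (simp add: X_def max_def)
      ultimately show ?thesis
        by (simp only: max.mono order_refl)
    qed
    then have "ereal ?C * ereal X \<le> ereal ?C * max (T_mem Q ?N) (ereal (real ?N))"
      by (rule ereal_mult_left_mono) (simp add: box_factor_nonneg)
    finally show "boxed_time pass M B Q I \<le> ereal ?C * max (T_mem Q ?N) (ereal (real ?N))" .
  qed
qed

end
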